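(* Let $S\subseteq R$ be a separable Frobenius extension of rings. If $\mathcal{GP}(S)$ is precovering in ${}_{S}\mathcal{M}$, then $\mathcal{GP}(R)$ is precovering in ${}_{R}\mathcal{M}$.
   Context: For a ring $R$, ${}_{R}\mathcal{M}$ is the category of left $R$-modules. Frobenius extension: an extension $S\subseteq R$ of rings (same identity) such that $R$ is finitely generated and projective as a left $S$-module and $R\cong\mathrm{Hom}_{S}({}_{S}R,S)$ as $R$-$S$-bimodules. Separable extension: the multiplication map $R\otimes_S R\to R$ is a split epimorphism of $R$-$R$-bimodules; for a Frobenius extension this is equivalent to the restriction functor ${}_{S}R\otimes_{R}-:{}_{R}\mathcal{M}\to{}_{S}\mathcal{M}$ being a separable functor. A separable Frobenius extension is a Frobenius extension that is separable. Gorenstein projective: a left $R$-module $M$ is Gorenstein projective if there is an exact complex of projective left $R$-modules $\mathbf{P}:\cdots\to P_1\to P_0\to P^0\to P^1\to\cdots$ with $M\cong\ker(P^0\to P^1)$ such that $\mathrm{Hom}_R(\mathbf{P},Q)$ is exact for every projective left $R$-module $Q$. $\mathcal{GP}(R)$ denotes the class of Gorenstein projective left $R$-modules. Precovering: for a class $\mathcal{X}$ of objects of an abelian category $\mathcal{A}$, a morphism $\varphi:X\to M$ with $X\in\mathcal{X}$ is an $\mathcal{X}$-precover of $M$ if for every morphism $f:X'\to M$ with $X'\in\mathcal{X}$ there is $g:X'\to X$ with $\varphi g=f$. $\mathcal{X}$ is precovering in $\mathcal{A}$ if every object of $\mathcal{A}$ has an $\mathcal{X}$-precover. *)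

theory Defs
  imports "HOL-Algebra.Module" "HOL-Algebra.Subrings" "HOL-Algebra.Free_Abelian_Groups" "HOL-Library.Equipollence"
begin

text \<open>
  The collection of all modules over a ring is a proper class. It is rendered relative to a type
  \<open>'u\<close> and a predicate \<open>small\<close> on subsets of \<open>'u\<close> telling which of them count as sets: the objects
  of the category of left modules are the left modules whose carrier is a small subset of \<open>'u\<close>.
  Only the closure properties below are required of \<open>small\<close>. If \<open>'u\<close> is a type of all
  ZFC sets and \<open>small A\<close> says that \<open>A\<close> is not a proper class, they hold (by infinity and
  replacement), and the objects are all modules, up to isomorphism; if \<open>'u\<close> is a Grothendieck
  universe and \<open>small A\<close> says that \<open>A\<close> is equipollent to an element of it, one gets the modules
  of that universe.
\<close>

locale small_sets =
  fixes small :: "'u set \<Rightarrow> bool"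
  assumes ex_infinite_small: "\<exists>A. infinite A \<and> small A"
    and small_lepoll: "\<lbrakk>small B; A \<lesssim> B\<rbrakk> \<Longrightarrow> small A"


section \<open>Left modules over a not necessarily commutative ring\<close>

text \<open>
  The library's \<^locale>\<open>module\<close> demands a commutative ring. Its record type is reused; as there, the
  fields \<open>mult\<close> and \<open>one\<close> of a module carry no meaning.
\<close>

locale left_module = R?: ring R + M?: abelian_group M
  for R :: "('a, 'k) ring_scheme" (structure) and M :: "('a, 'm, 'x) module_scheme" (structure) +
  assumes smult_closed: "\<lbrakk>a \<in> carrier R; x \<in> carrier M\<rbrakk> \<Longrightarrow> a \<odot>\<^bsub>M\<^esub> x \<in> carrier M"
    and smult_l_distr: "\<lbrakk>a \<in> carrier R; b \<in> carrier R; x \<in> carrier M\<rbrakk> \<Longrightarrow>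
      (a \<oplus> b) \<odot>\<^bsub>M\<^esub> x = a \<odot>\<^bsub>M\<^esub> x \<oplus>\<^bsub>M\<^esub> b \<odot>\<^bsub>M\<^esub> x"
    and smult_r_distr: "\<lbrakk>a \<in> carrier R; x \<in> carrier M; y \<in> carrier M\<rbrakk> \<Longrightarrow>
      a \<odot>\<^bsub>M\<^esub> (x \<oplus>\<^bsub>M\<^esub> y) = a \<odot>\<^bsub>M\<^esub> x \<oplus>\<^bsub>M\<^esub> a \<odot>\<^bsub>M\<^esub> y"
    and smult_assoc: "\<lbrakk>a \<in> carrier R; b \<in> carrier R; x \<in> carrier M\<rbrakk> \<Longrightarrow>
      (a \<otimes> b) \<odot>\<^bsub>M\<^esub> x = a \<odot>\<^bsub>M\<^esub> (b \<odot>\<^bsub>M\<^esub> x)"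
    and smult_one: "x \<in> carrier M \<Longrightarrow> \<one> \<odot>\<^bsub>M\<^esub> x = x"

definition left_modules ::
    "('u set \<Rightarrow> bool) \<Rightarrow> ('a, 'k) ring_scheme \<Rightarrow> ('a, 'u) module set" where
  "left_modules small R = {M. left_module R M \<and> small (carrier M)}"

text \<open>Homomorphisms are extensional, so that equality of homomorphisms is equality of functions,
  and \<open>compose (carrier M) g f\<close> is composition of morphisms.\<close>

definition mod_hom ::
    "('a, 'k) ring_scheme \<Rightarrow> ('a, 'm, 'x) module_scheme \<Rightarrow> ('a, 'n, 'y) module_scheme
      \<Rightarrow> ('m \<Rightarrow> 'n) set" where
  "mod_hom R M N = {f \<in> carrier M \<rightarrow>\<^sub>E carrier N.
     (\<forall>x\<in>carrier M. \<forall>y\<in>carrier M. f (x \<oplus>\<^bsub>M\<^esub> y) = f x \<oplus>\<^bsub>N\<^esub> f y) \<and>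
     (\<forall>r\<in>carrier R. \<forall>x\<in>carrier M. f (r \<odot>\<^bsub>M\<^esub> x) = r \<odot>\<^bsub>N\<^esub> f x)}"

definition mod_iso ::
    "('a, 'k) ring_scheme \<Rightarrow> ('a, 'm, 'x) module_scheme \<Rightarrow> ('a, 'n, 'y) module_scheme \<Rightarrow> bool" where
  "mod_iso R M N \<longleftrightarrow> (\<exists>f\<in>mod_hom R M N. bij_betw f (carrier M) (carrier N))"

definition mod_ker ::
    "('a, 'm, 'x) module_scheme \<Rightarrow> ('a, 'n, 'y) module_scheme \<Rightarrow> ('m \<Rightarrow> 'n)
      \<Rightarrow> ('a, 'm, 'x) module_scheme" where
  "mod_ker M N f = M\<lparr>carrier := {x \<in> carrier M. f x = \<zero>\<^bsub>N\<^esub>}\<rparr>"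

definition finitely_generated ::
    "('a, 'k) ring_scheme \<Rightarrow> ('a, 'm, 'x) module_scheme \<Rightarrow> bool" where
  "finitely_generated R M \<longleftrightarrow>
     (\<exists>A. finite A \<and> A \<subseteq> carrier M \<and>
        carrier M = {\<Oplus>\<^bsub>M\<^esub>a\<in>A. c a \<odot>\<^bsub>M\<^esub> a | c. c \<in> A \<rightarrow> carrier R})"

definition projective ::
    "('u set \<Rightarrow> bool) \<Rightarrow> ('a, 'k) ring_scheme \<Rightarrow> ('a, 'm, 'x) module_scheme \<Rightarrow> bool" where
  "projective small R P \<longleftrightarrow> left_module R P \<and>
     (\<forall>M\<in>left_modules small R. \<forall>N\<in>left_modules small R.
        \<forall>p\<in>mod_hom R M N. p ` carrier M = carrier N \<longrightarrow>
          (\<forall>f\<in>mod_hom R P N. \<exists>g\<in>mod_hom R P M. compose (carrier P) p g = f))"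


section \<open>Gorenstein projective modules\<close>

text \<open>A complex \<open>\<dots> \<rightarrow> P (-1) \<rightarrow> P 0 \<rightarrow> P 1 \<rightarrow> \<dots>\<close> with maps \<open>d n\<close> from \<open>P n\<close> to \<open>P (n + 1)\<close>: the
  module \<open>P\<^sup>n\<close> is \<open>P n\<close> and \<open>P\<^sub>n\<close> is \<open>P (- n - 1)\<close>.\<close>

definition exact_complex ::
    "('a, 'k) ring_scheme \<Rightarrow> (int \<Rightarrow> ('a, 'u) module) \<Rightarrow> (int \<Rightarrow> 'u \<Rightarrow> 'u) \<Rightarrow> bool" where
  "exact_complex R P d \<longleftrightarrow>
     (\<forall>n. d n \<in> mod_hom R (P n) (P (n + 1))) \<and>
     (\<forall>n. d n ` carrier (P n) = carrier (mod_ker (P (n + 1)) (P (n + 2)) (d (n + 1))))"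

text \<open>Exactness of \<open>Hom(P (n + 2), Q) \<rightarrow> Hom(P (n + 1), Q) \<rightarrow> Hom(P n, Q)\<close> for all \<open>n\<close>.\<close>

definition Hom_exact ::
    "('a, 'k) ring_scheme \<Rightarrow> (int \<Rightarrow> ('a, 'u) module) \<Rightarrow> (int \<Rightarrow> 'u \<Rightarrow> 'u) \<Rightarrow> ('a, 'u) module
      \<Rightarrow> bool" where
  "Hom_exact R P d Q \<longleftrightarrow>
     (\<forall>n. (\<lambda>g. compose (carrier (P (n + 1))) g (d (n + 1))) ` mod_hom R (P (n + 2)) Q =
       {f \<in> mod_hom R (P (n + 1)) Q.
          compose (carrier (P n)) f (d n) = (\<lambda>x\<in>carrier (P n). \<zero>\<^bsub>Q\<^esub>)})"

definition gorenstein_projectives ::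
    "('u set \<Rightarrow> bool) \<Rightarrow> ('a, 'k) ring_scheme \<Rightarrow> ('a, 'u) module set" where
  "gorenstein_projectives small R =
     {M \<in> left_modules small R.
        \<exists>P d. (\<forall>n. P n \<in> left_modules small R \<and> projective small R (P n)) \<and>
          exact_complex R P d \<and>
          mod_iso R M (mod_ker (P 0) (P 1) (d 0)) \<and>
          (\<forall>Q\<in>left_modules small R. projective small R Q \<longrightarrow> Hom_exact R P d Q)}"


section \<open>Precovering classes\<close>

definition precover ::
    "('a, 'k) ring_scheme \<Rightarrow> ('a, 'u) module set \<Rightarrow> ('a, 'u) module \<Rightarrow> ('a, 'u) module
      \<Rightarrow> ('u \<Rightarrow> 'u) \<Rightarrow> bool" where
  "precover R \<C> M X \<phi> \<longleftrightarrow> X \<in> \<C> \<and> \<phi> \<in> mod_hom R X M \<and>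
     (\<forall>X'\<in>\<C>. \<forall>f\<in>mod_hom R X' M. \<exists>g\<in>mod_hom R X' X. compose (carrier X') \<phi> g = f)"

definition precovering ::
    "('u set \<Rightarrow> bool) \<Rightarrow> ('a, 'k) ring_scheme \<Rightarrow> ('a, 'u) module set \<Rightarrow> bool" where
  "precovering small R \<C> \<longleftrightarrow> (\<forall>M\<in>left_modules small R. \<exists>X \<phi>. precover R \<C> M X \<phi>)"


section \<open>Bimodules\<close>

text \<open>In an \<open>R\<close>-\<open>S\<close>-bimodule \<open>M\<close>, \<open>rsmult M x s\<close> is the right action of \<open>s\<close> on \<open>x\<close>.\<close>

record ('a, 'b, 'm) bimodule = "('a, 'm) module" +
  rsmult :: "'m \<Rightarrow> 'b \<Rightarrow> 'm"

definition bimod_hom ::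
    "('a, 'k) ring_scheme \<Rightarrow> ('b, 'l) ring_scheme \<Rightarrow> ('a, 'b, 'm) bimodule \<Rightarrow> ('a, 'b, 'n) bimodule
      \<Rightarrow> ('m \<Rightarrow> 'n) set" where
  "bimod_hom R S M N = {f \<in> mod_hom R M N.
     \<forall>x\<in>carrier M. \<forall>s\<in>carrier S. f (rsmult M x s) = rsmult N (f x) s}"

definition bimod_iso ::
    "('a, 'k) ring_scheme \<Rightarrow> ('b, 'l) ring_scheme \<Rightarrow> ('a, 'b, 'm) bimodule \<Rightarrow> ('a, 'b, 'n) bimodule
      \<Rightarrow> bool" where
  "bimod_iso R S M N \<longleftrightarrow> (\<exists>f\<in>bimod_hom R S M N. bij_betw f (carrier M) (carrier N))"

text \<open>\<open>R\<close> as a bimodule over itself. Since the scalars are only constrained by the ring arguments of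
  \<^const>\<open>mod_hom\<close>, \<^const>\<open>bimod_hom\<close> etc., the same record is \<open>R\<close> as a module over any subring,
  on either side.\<close>

definition regular_bimodule :: "('a, 'k) ring_scheme \<Rightarrow> ('a, 'a, 'a) bimodule" where
  "regular_bimodule R =
     \<lparr>carrier = carrier R, monoid.mult = monoid.mult R, one = \<one>\<^bsub>R\<^esub>,
      ring.zero = \<zero>\<^bsub>R\<^esub>, ring.add = ring.add R,
      smult = monoid.mult R, rsmult = monoid.mult R\<rparr>"

text \<open>For an \<open>S\<close>-\<open>R\<close>-bimodule \<open>M\<close> and an \<open>S\<close>-\<open>T\<close>-bimodule \<open>N\<close>, the left \<open>S\<close>-linear maps from \<open>M\<close>
  to \<open>N\<close> form an \<open>R\<close>-\<open>T\<close>-bimodule via \<open>(r f t)(x) = f(x r) t\<close>.\<close>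

definition Hom_bimodule ::
    "('a, 'k) ring_scheme \<Rightarrow> ('a, 'b, 'm) bimodule \<Rightarrow> ('a, 'c, 'n) bimodule
      \<Rightarrow> ('b, 'c, 'm \<Rightarrow> 'n) bimodule" where
  "Hom_bimodule S M N =
     \<lparr>carrier = mod_hom S M N, monoid.mult = undefined, one = undefined,
      ring.zero = (\<lambda>x\<in>carrier M. \<zero>\<^bsub>N\<^esub>),
      ring.add = (\<lambda>f g. \<lambda>x\<in>carrier M. f x \<oplus>\<^bsub>N\<^esub> g x),
      smult = (\<lambda>r f. \<lambda>x\<in>carrier M. f (rsmult M x r)),
      rsmult = (\<lambda>f t. \<lambda>x\<in>carrier M. rsmult N (f x) t)\<rparr>"

text \<open>For an \<open>R\<close>-\<open>S\<close>-bimodule \<open>M\<close> and an \<open>S\<close>-\<open>T\<close>-bimodule \<open>N\<close>, the \<open>R\<close>-\<open>T\<close>-bimodule \<open>M \<otimes>\<^sub>S N\<close> is the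
  quotient of the free abelian group on pairs by the subgroup \<open>K\<close> generated by the relations of
  bilinearity and \<open>S\<close>-balance. Its elements are cosets of \<open>K\<close>; the image of a coset under a map
  preserving \<open>K\<close> need not be a full coset, and is completed to one by adding \<open>K\<close>.\<close>

definition tensor_relations ::
    "('b, 'l) ring_scheme \<Rightarrow> ('a, 'b, 'm) bimodule \<Rightarrow> ('b, 'c, 'n) bimodule
      \<Rightarrow> ('m \<times> 'n \<Rightarrow>\<^sub>0 int) set" where
  "tensor_relations S M N =
     {frag_of (x \<oplus>\<^bsub>M\<^esub> x', y) - frag_of (x, y) - frag_of (x', y) | x x' y.
        x \<in> carrier M \<and> x' \<in> carrier M \<and> y \<in> carrier N} \<union>
     {frag_of (x, y \<oplus>\<^bsub>N\<^esub> y') - frag_of (x, y) - frag_of (x, y') | x y y'.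
        x \<in> carrier M \<and> y \<in> carrier N \<and> y' \<in> carrier N} \<union>
     {frag_of (rsmult M x s, y) - frag_of (x, s \<odot>\<^bsub>N\<^esub> y) | x s y.
        x \<in> carrier M \<and> s \<in> carrier S \<and> y \<in> carrier N}"

definition tensor_bimodule ::
    "('b, 'l) ring_scheme \<Rightarrow> ('a, 'b, 'm) bimodule \<Rightarrow> ('b, 'c, 'n) bimodule
      \<Rightarrow> ('a, 'c, ('m \<times> 'n \<Rightarrow>\<^sub>0 int) set) bimodule" where
  "tensor_bimodule S M N =
     (let F = free_Abelian_group (carrier M \<times> carrier N);
          K = generate F (tensor_relations S M N)
      in \<lparr>carrier = carrier (F Mod K), monoid.mult = undefined, one = undefined,
          ring.zero = \<one>\<^bsub>F Mod K\<^esub>, ring.add = monoid.mult (F Mod K),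
          smult = (\<lambda>r C. K <#>\<^bsub>F\<^esub> frag_extend (\<lambda>(x, y). frag_of (r \<odot>\<^bsub>M\<^esub> x, y)) ` C),
          rsmult = (\<lambda>C t. K <#>\<^bsub>F\<^esub> frag_extend (\<lambda>(x, y). frag_of (x, rsmult N y t)) ` C)\<rparr>)"


section \<open>Separable Frobenius extensions\<close>

text \<open>Below, \<open>S\<close> is a subring of \<open>R\<close>, given by its carrier; as in the library's \<^locale>\<open>subring\<close>
  it contains the identity of \<open>R\<close>.\<close>

definition frobenius_extension ::
    "('u set \<Rightarrow> bool) \<Rightarrow> 'a set \<Rightarrow> ('a, 'k) ring_scheme \<Rightarrow> bool" where
  "frobenius_extension small S R \<longleftrightarrow> ring R \<and> subring S R \<and>
     finitely_generated (R\<lparr>carrier := S\<rparr>) (regular_bimodule R) \<and>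
     projective small (R\<lparr>carrier := S\<rparr>) (regular_bimodule R) \<and>
     bimod_iso R (R\<lparr>carrier := S\<rparr>) (regular_bimodule R)
       (Hom_bimodule (R\<lparr>carrier := S\<rparr>) (regular_bimodule R)
          (regular_bimodule (R\<lparr>carrier := S\<rparr>)))"

definition self_tensor ::
    "'a set \<Rightarrow> ('a, 'k) ring_scheme \<Rightarrow> ('a, 'a, ('a \<times> 'a \<Rightarrow>\<^sub>0 int) set) bimodule" where
  "self_tensor S R =
     tensor_bimodule (R\<lparr>carrier := S\<rparr>) (regular_bimodule R) (regular_bimodule R)"

text \<open>The map \<open>R \<otimes>\<^sub>S R \<rightarrow> R\<close> sending \<open>x \<otimes> y\<close> to \<open>x y\<close>: all representatives of a coset have the
  same value.\<close>

definition multiplication_map ::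
    "'a set \<Rightarrow> ('a, 'k) ring_scheme \<Rightarrow> ('a \<times> 'a \<Rightarrow>\<^sub>0 int) set \<Rightarrow> 'a" where
  "multiplication_map S R = (\<lambda>C\<in>carrier (self_tensor S R).
     the_elem ((\<lambda>c. \<Oplus>\<^bsub>R\<^esub>p\<in>Poly_Mapping.keys c.
       add_pow R (Poly_Mapping.lookup c p) (fst p \<otimes>\<^bsub>R\<^esub> snd p)) ` C))"

definition separable_extension :: "'a set \<Rightarrow> ('a, 'k) ring_scheme \<Rightarrow> bool" where
  "separable_extension S R \<longleftrightarrow> ring R \<and> subring S R \<and>
     (\<exists>\<sigma>\<in>bimod_hom R R (regular_bimodule R) (self_tensor S R).
        compose (carrier R) (multiplication_map S R) \<sigma> = (\<lambda>x\<in>carrier R. x))"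

definition separable_frobenius_extension ::
    "('u set \<Rightarrow> bool) \<Rightarrow> 'a set \<Rightarrow> ('a, 'k) ring_scheme \<Rightarrow> bool" where
  "separable_frobenius_extension small S R \<longleftrightarrow>
     frobenius_extension small S R \<and> separable_extension S R"

end

theory Submission
  imports Defs
begin

text \<open>
  \<^bold>\<open>Why the corollary holds.\<close> Let \<open>U\<close> be restriction of scalars along \<open>S \<subseteq> R\<close>. For a Frobenius extension
  \<open>U\<close> has an exact functor \<open>Ind\<close> as left and as right adjoint. Having adjoints with these properties on
  both sides, \<open>U\<close> and \<open>Ind\<close> both preserve projective modules, and the adjunctions transport the
  exactness of \<open>Hom(P, Q)\<close> for projective \<open>Q\<close>; so both preserve Gorenstein projective modules. Given an
  \<open>R\<close>-module \<open>M\<close> and a Gorenstein projective precover \<open>g : G \<rightarrow> U M\<close>, the adjunct \<open>Ind G \<rightarrow> M\<close> of \<open>g\<close> is a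
  precover of \<open>M\<close>: for \<open>f : X \<rightarrow> M\<close>, separability allows \<open>f\<close> to be recovered from an \<open>S\<close>-linear map
  that factors through \<open>g\<close>.

  \<^bold>\<open>How the adjunctions are handled.\<close> The isomorphism \<open>R \<cong> Hom\<^sub>S(R, S)\<close> and a dual basis of the
  finitely generated projective \<open>S\<close>-module \<open>R\<close> give an \<open>S\<close>-\<open>S\<close>-linear map \<open>E : R \<rightarrow> S\<close>, a finite set
  \<open>A \<subseteq> R\<close> and elements \<open>x\<^sub>a\<close> with \<open>\<Sum>\<^sub>a E(r x\<^sub>a) a = r = \<Sum>\<^sub>a x\<^sub>a E(a r)\<close>. The element
  \<open>\<Sum>\<^sub>a x\<^sub>a \<otimes> a\<close> of \<open>R \<otimes>\<^sub>S R\<close> then commutes with \<open>R\<close>, so that every \<open>S\<close>-linear map \<open>h\<close> between \<open>R\<close>-modules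
  has an \<open>R\<close>-linear \<^emph>\<open>trace\<close> \<open>T(h) = \<Sum>\<^sub>a x\<^sub>a h(a \<cdot>)\<close>, and \<open>T(g h) = g T(h)\<close>, \<open>T(h g) = T(h) g\<close> for \<open>R\<close>-linear
  \<open>g\<close>. An induced module of an \<open>S\<close>-module \<open>N\<close> is an \<open>R\<close>-module \<open>C\<close> with \<open>S\<close>-linear maps
  \<open>\<epsilon> : C \<rightarrow> N\<close> and \<open>\<eta> : N \<rightarrow> C\<close> such that \<open>\<epsilon>(r \<eta>(n)) = E(r) n\<close> and \<open>T(\<eta> \<epsilon>) = id\<close>. These two
  identities encode both adjunctions: \<open>\<epsilon> T(\<eta> f) = f\<close> for \<open>f : X \<rightarrow> N\<close>, and \<open>T(f \<epsilon>) \<eta> = f\<close> for \<open>f : N \<rightarrow> X\<close>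
  (lemmas \<open>induced_right_adjoint\<close> and \<open>induced_left_adjoint\<close>), and all arguments with \<open>Ind\<close>
  become short calculations with traces. The module \<open>Hom\<^sub>S(R, N)\<close> is an induced module; it is no larger than
  the finite power \<open>N\<^sup>A\<close> and hence has a small copy.

  \<^bold>\<open>How separability enters.\<close> Applying \<open>u \<otimes> v \<mapsto> E(u) v\<close> to a separability element of \<open>R \<otimes>\<^sub>S R\<close> yields
  \<open>c \<in> R\<close> that commutes with \<open>S\<close> and satisfies \<open>\<Sum>\<^sub>a x\<^sub>a c a = 1\<close>
  (lemma \<open>separable_central_element\<close>). In other words, multiplication by \<open>c\<close> is \<open>S\<close>-linear on every
  \<open>R\<close>-module and has trace the identity. For \<open>f : X \<rightarrow> M\<close> one lifts \<open>f c\<close> through \<open>g\<close> to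
  \<open>h : X \<rightarrow> G\<close>; then \<open>T(g \<epsilon>) T(\<eta> h) = T(g h) = T(f c) = f T(c) = f\<close> (lemma \<open>precovering_induced\<close>).
\<close>

section \<open>Linear maps\<close>

text \<open>The linearity part of \<^const>\<open>mod_hom\<close>. Leaving extensionality aside lets linear maps be composed as
  ordinary functions.\<close>
definition lin_map ::
    "('a, 'k) ring_scheme \<Rightarrow> ('a, 'm, 'x) module_scheme \<Rightarrow> ('a, 'n, 'y) module_scheme
      \<Rightarrow> ('m \<Rightarrow> 'n) \<Rightarrow> bool" where
  "lin_map R M N f \<longleftrightarrow> f \<in> carrier M \<rightarrow> carrier N \<and>
     (\<forall>x\<in>carrier M. \<forall>y\<in>carrier M. f (x \<oplus>\<^bsub>M\<^esub> y) = f x \<oplus>\<^bsub>N\<^esub> f y) \<and>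
     (\<forall>r\<in>carrier R. \<forall>x\<in>carrier M. f (r \<odot>\<^bsub>M\<^esub> x) = r \<odot>\<^bsub>N\<^esub> f x)"

lemma lin_mapI:
  assumes "\<And>x. x \<in> carrier M \<Longrightarrow> f x \<in> carrier N"
    and "\<And>x y. \<lbrakk>x \<in> carrier M; y \<in> carrier M\<rbrakk> \<Longrightarrow> f (x \<oplus>\<^bsub>M\<^esub> y) = f x \<oplus>\<^bsub>N\<^esub> f y"
    and "\<And>r x. \<lbrakk>r \<in> carrier R; x \<in> carrier M\<rbrakk> \<Longrightarrow> f (r \<odot>\<^bsub>M\<^esub> x) = r \<odot>\<^bsub>N\<^esub> f x"
  shows "lin_map R M N f"
  using assms by (auto simp: lin_map_def)

lemma lin_map_closed: "\<lbrakk>lin_map R M N f; x \<in> carrier M\<rbrakk> \<Longrightarrow> f x \<in> carrier N"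
  and lin_map_add: "\<lbrakk>lin_map R M N f; x \<in> carrier M; y \<in> carrier M\<rbrakk> \<Longrightarrow> f (x \<oplus>\<^bsub>M\<^esub> y) = f x \<oplus>\<^bsub>N\<^esub> f y"
  and lin_map_smult: "\<lbrakk>lin_map R M N f; r \<in> carrier R; x \<in> carrier M\<rbrakk> \<Longrightarrow> f (r \<odot>\<^bsub>M\<^esub> x) = r \<odot>\<^bsub>N\<^esub> f x"
  by (auto simp: lin_map_def)

lemma lin_map_compose: "\<lbrakk>lin_map R M N f; lin_map R N L g\<rbrakk> \<Longrightarrow> lin_map R M L (\<lambda>x. g (f x))"
  by (auto simp: lin_map_def Pi_iff)

lemma lin_map_subring: "\<lbrakk>lin_map R M N f; S \<subseteq> carrier R\<rbrakk> \<Longrightarrow> lin_map (R\<lparr>carrier := S\<rparr>) M N f"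
  by (auto simp: lin_map_def)

lemma mod_hom_iff: "f \<in> mod_hom R M N \<longleftrightarrow> lin_map R M N f \<and> f \<in> extensional (carrier M)"
  by (auto simp: mod_hom_def lin_map_def PiE_def)

lemma restrict_mod_hom:
  assumes "left_module R M" "lin_map R M N f"
  shows "restrict f (carrier M) \<in> mod_hom R M N"
proof -
  interpret left_module R M by fact
  show ?thesis
    using assms(2) by (auto simp: mod_hom_def lin_map_def smult_closed)
qed

lemma additive_zero:
  assumes "abelian_group M" "abelian_group N"
    and "\<And>x. x \<in> carrier M \<Longrightarrow> f x \<in> carrier N"
    and add: "\<And>x y. \<lbrakk>x \<in> carrier M; y \<in> carrier M\<rbrakk> \<Longrightarrow> f (x \<oplus>\<^bsub>M\<^esub> y) = f x \<oplus>\<^bsub>N\<^esub> f y"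
  shows "f \<zero>\<^bsub>M\<^esub> = \<zero>\<^bsub>N\<^esub>"
proof -
  interpret M: abelian_group M by fact
  interpret N: abelian_group N by fact
  have "f \<zero>\<^bsub>M\<^esub> \<oplus>\<^bsub>N\<^esub> f \<zero>\<^bsub>M\<^esub> = f \<zero>\<^bsub>M\<^esub>"
    using add[of "\<zero>\<^bsub>M\<^esub>" "\<zero>\<^bsub>M\<^esub>"] by simp
  then show ?thesis
    using assms(3) N.add.l_cancel_one by blast
qed

lemma additive_finsum:
  assumes "abelian_group M" "abelian_group N"
    and "\<And>x. x \<in> carrier M \<Longrightarrow> f x \<in> carrier N"
    and add: "\<And>x y. \<lbrakk>x \<in> carrier M; y \<in> carrier M\<rbrakk> \<Longrightarrow> f (x \<oplus>\<^bsub>M\<^esub> y) = f x \<oplus>\<^bsub>N\<^esub> f y"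
    and "g \<in> A \<rightarrow> carrier M" "finite A"
  shows "f (\<Oplus>\<^bsub>M\<^esub>a\<in>A. g a) = (\<Oplus>\<^bsub>N\<^esub>a\<in>A. f (g a))"
proof -
  interpret M: abelian_group M by fact
  interpret N: abelian_group N by fact
  have f0: "f \<zero>\<^bsub>M\<^esub> = \<zero>\<^bsub>N\<^esub>"
    using assms(1-4) by (rule additive_zero)
  show ?thesis
    using assms(6,5)
    by (induction A) (auto simp: f0 add assms(3) Pi_iff M.finsum_closed M.finsum_insert N.finsum_insert)
qed

lemma lin_map_zero:
  assumes "left_module R M" "left_module R N" "lin_map R M N f"
  shows "f \<zero>\<^bsub>M\<^esub> = \<zero>\<^bsub>N\<^esub>"
  using assms lin_map_add[OF assms(3)] lin_map_closed[OF assms(3)]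
  by (intro additive_zero) (auto simp: left_module_def)

lemma lin_map_finsum:
  assumes "left_module R M" "left_module R N" "lin_map R M N f" "g \<in> A \<rightarrow> carrier M" "finite A"
  shows "f (\<Oplus>\<^bsub>M\<^esub>a\<in>A. g a) = (\<Oplus>\<^bsub>N\<^esub>a\<in>A. f (g a))"
  using assms lin_map_add[OF assms(3)] lin_map_closed[OF assms(3)]
  by (intro additive_finsum) (auto simp: left_module_def)

context left_module
begin

lemma smult_zero: "r \<in> carrier R \<Longrightarrow> r \<odot>\<^bsub>M\<^esub> \<zero>\<^bsub>M\<^esub> = \<zero>\<^bsub>M\<^esub>"
  by (rule additive_zero) (auto simp: smult_closed smult_r_distr M.abelian_group_axioms)

lemma smult_finsum:
  assumes "r \<in> carrier R" "g \<in> A \<rightarrow> carrier M" "finite A"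
  shows "r \<odot>\<^bsub>M\<^esub> (\<Oplus>\<^bsub>M\<^esub>a\<in>A. g a) = (\<Oplus>\<^bsub>M\<^esub>a\<in>A. r \<odot>\<^bsub>M\<^esub> g a)"
  using assms by (intro additive_finsum) (auto simp: smult_closed smult_r_distr M.abelian_group_axioms)

lemma finsum_smult:
  assumes "u \<in> carrier M" "g \<in> A \<rightarrow> carrier R" "finite A"
  shows "(\<Oplus>\<^bsub>R\<^esub>a\<in>A. g a) \<odot>\<^bsub>M\<^esub> u = (\<Oplus>\<^bsub>M\<^esub>a\<in>A. g a \<odot>\<^bsub>M\<^esub> u)"
  using assms additive_finsum[of R M "\<lambda>r. r \<odot>\<^bsub>M\<^esub> u" g A]
  by (auto simp: smult_closed smult_l_distr M.abelian_group_axioms R.abelian_group_axioms)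

lemma restrict_scalars:
  assumes "subring S R"
  shows "left_module (R\<lparr>carrier := S\<rparr>) M"
proof -
  interpret S: subring S R by fact
  have "S \<subseteq> carrier R" by (rule S.subset)
  moreover have "ring (R\<lparr>carrier := S\<rparr>)" by (rule R.subring_is_ring) fact
  ultimately show ?thesis
    by (auto simp: left_module_def left_module_axioms_def smult_closed smult_l_distr smult_r_distr
        smult_assoc smult_one M.abelian_group_axioms subset_iff)
qed

end

lemma (in abelian_monoid) finsum_swap:
  assumes "finite A" "finite B" "\<And>a b. \<lbrakk>a \<in> A; b \<in> B\<rbrakk> \<Longrightarrow> f a b \<in> carrier G"
  shows "(\<Oplus>a\<in>A. \<Oplus>b\<in>B. f a b) = (\<Oplus>b\<in>B. \<Oplus>a\<in>A. f a b)"
  using assms(1,3)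
proof (induction A)
  case empty
  then show ?case by (simp add: finsum_zero)
next
  case (insert a A)
  have "(\<Oplus>b\<in>B. \<Oplus>a\<in>insert a A. f a b) = (\<Oplus>b\<in>B. f a b \<oplus> (\<Oplus>a\<in>A. f a b))"
    using insert by (intro finsum_cong') (auto simp: Pi_iff finsum_insert)
  also have "\<dots> = (\<Oplus>b\<in>B. f a b) \<oplus> (\<Oplus>b\<in>B. \<Oplus>a\<in>A. f a b)"
    using insert by (intro finsum_addf) auto
  finally show ?case
    using insert by (simp add: finsum_insert Pi_iff)
qed

section \<open>Elementwise forms of projectivity, precovers and Gorenstein projectivity\<close>

text \<open>The characterizations of this section replace equations between extensional compositions by
  pointwise equations between linear maps.\<close>
lemma projective_iff:
  "projective small R P \<longleftrightarrow> left_module R P \<and>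
     (\<forall>M\<in>left_modules small R. \<forall>N\<in>left_modules small R. \<forall>p f.
        lin_map R M N p \<longrightarrow> p ` carrier M = carrier N \<longrightarrow> lin_map R P N f \<longrightarrow>
          (\<exists>g. lin_map R P M g \<and> (\<forall>x\<in>carrier P. p (g x) = f x)))" (is "?L \<longleftrightarrow> ?R")
proof
  assume L: ?L
  then have P: "left_module R P" by (simp add: projective_def)
  show ?R
  proof (intro conjI ballI allI impI P)
    fix M N p f
    assume MN: "M \<in> left_modules small R" "N \<in> left_modules small R"
      and p: "lin_map R M N p" "p ` carrier M = carrier N" and f: "lin_map R P N f"
    have M: "left_module R M" using MN by (simp add: left_modules_def)
    have 1: "restrict p (carrier M) \<in> mod_hom R M N" "restrict f (carrier P) \<in> mod_hom R P N"
      by (simp_all add: restrict_mod_hom M P p f)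
    have 2: "restrict p (carrier M) ` carrier M = carrier N"
      using p(2) by (simp add: image_restrict_eq)
    obtain g where g: "g \<in> mod_hom R P M"
        "compose (carrier P) (restrict p (carrier M)) g = restrict f (carrier P)"
      using L 1 2 MN unfolding projective_def by blast
    have "p (g x) = f x" if "x \<in> carrier P" for x
      using fun_cong[OF g(2), of x] that g(1) by (auto simp: compose_def mod_hom_iff dest: lin_map_closed)
    then show "\<exists>g. lin_map R P M g \<and> (\<forall>x\<in>carrier P. p (g x) = f x)"
      using g(1) by (auto simp: mod_hom_iff)
  qed
next
  assume R: ?R
  then have P: "left_module R P" by simp
  show ?L
    unfolding projective_def
  proof (intro conjI ballI allI impI P)
    fix M N p f
    assume MN: "M \<in> left_modules small R" "N \<in> left_modules small R"
      and p: "p \<in> mod_hom R M N" "p ` carrier M = carrier N" and f: "f \<in> mod_hom R P N"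
    then obtain g where g: "lin_map R P M g" "\<And>x. x \<in> carrier P \<Longrightarrow> p (g x) = f x"
      using R by (force simp: mod_hom_iff)
    have "compose (carrier P) p (restrict g (carrier P)) = f"
      using g f by (auto simp: compose_def mod_hom_iff fun_eq_iff extensional_def)
    then show "\<exists>g\<in>mod_hom R P M. compose (carrier P) p g = f"
      using restrict_mod_hom[OF P g(1)] by blast
  qed
qed

lemma precover_iff:
  assumes "\<C> \<subseteq> left_modules small R"
  shows "precover R \<C> M X \<phi> \<longleftrightarrow> X \<in> \<C> \<and> \<phi> \<in> mod_hom R X M \<and>
     (\<forall>X'\<in>\<C>. \<forall>f. lin_map R X' M f \<longrightarrow>
        (\<exists>g. lin_map R X' X g \<and> (\<forall>u\<in>carrier X'. \<phi> (g u) = f u)))" (is "?L \<longleftrightarrow> ?R")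
proof
  assume L: ?L
  have "\<exists>g. lin_map R X' X g \<and> (\<forall>u\<in>carrier X'. \<phi> (g u) = f u)"
    if "X' \<in> \<C>" "lin_map R X' M f" for X' f
  proof -
    have "restrict f (carrier X') \<in> mod_hom R X' M"
      using that assms by (auto simp: left_modules_def intro: restrict_mod_hom)
    then obtain g where g: "g \<in> mod_hom R X' X" "compose (carrier X') \<phi> g = restrict f (carrier X')"
      using L \<open>X' \<in> \<C>\<close> unfolding precover_def by blast
    have "\<phi> (g u) = f u" if "u \<in> carrier X'" for u
      using fun_cong[OF g(2), of u] that by (simp add: compose_def)
    then show ?thesis using g(1) by (auto simp: mod_hom_iff)
  qed
  then show ?R using L by (auto simp: precover_def)
next
  assume R: ?R
  have "\<exists>g\<in>mod_hom R X' X. compose (carrier X') \<phi> g = f" if X': "X' \<in> \<C>" and f: "f \<in> mod_hom R X' M" for X' f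
  proof -
    obtain g where g: "lin_map R X' X g" "\<And>u. u \<in> carrier X' \<Longrightarrow> \<phi> (g u) = f u"
      using R X' f unfolding mod_hom_iff by blast
    have "compose (carrier X') \<phi> (restrict g (carrier X')) = f"
      using g f by (auto simp: compose_def mod_hom_iff fun_eq_iff extensional_def)
    moreover have "restrict g (carrier X') \<in> mod_hom R X' X"
      using g X' assms by (auto simp: left_modules_def intro: restrict_mod_hom)
    ultimately show ?thesis by blast
  qed
  then show ?L using R by (auto simp: precover_def)
qed

lemma exact_complexI:
  assumes "\<And>n. left_module R (P n)" "\<And>n. lin_map R (P n) (P (n + 1)) (d n)"
    and "\<And>n. d n ` carrier (P n) = {u \<in> carrier (P (n + 1)). d (n + 1) u = \<zero>\<^bsub>P (n + 2)\<^esub>}"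
  shows "exact_complex R P (\<lambda>n. restrict (d n) (carrier (P n)))"
  unfolding exact_complex_def
  using assms by (auto simp: restrict_mod_hom mod_ker_def image_restrict_eq)

lemma exact_complexD:
  assumes "exact_complex R P d"
  shows "lin_map R (P n) (P (n + 1)) (d n)"
    and "d n ` carrier (P n) = {u \<in> carrier (P (n + 1)). d (n + 1) u = \<zero>\<^bsub>P (n + 2)\<^esub>}"
  using assms by (auto simp: exact_complex_def mod_hom_iff mod_ker_def)

lemma Hom_exact_iff:
  assumes P: "\<And>n. left_module R (P n)" and Q: "left_module R Q" and d: "exact_complex R P d"
  shows "Hom_exact R P d Q \<longleftrightarrow>
     (\<forall>n f. lin_map R (P (n + 1)) Q f \<longrightarrow> (\<forall>u\<in>carrier (P n). f (d n u) = \<zero>\<^bsub>Q\<^esub>) \<longrightarrow>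
       (\<exists>g. lin_map R (P (n + 2)) Q g \<and> (\<forall>u\<in>carrier (P (n + 1)). g (d (n + 1) u) = f u)))"
    (is "?L \<longleftrightarrow> ?R")
proof
  assume L: ?L
  show ?R
  proof (intro allI impI)
    fix n f
    assume f: "lin_map R (P (n + 1)) Q f" and fd: "\<forall>u\<in>carrier (P n). f (d n u) = \<zero>\<^bsub>Q\<^esub>"
    have "restrict f (carrier (P (n + 1))) \<in> mod_hom R (P (n + 1)) Q"
      using P f by (rule restrict_mod_hom)
    moreover have "compose (carrier (P n)) (restrict f (carrier (P (n + 1)))) (d n) = (\<lambda>u\<in>carrier (P n). \<zero>\<^bsub>Q\<^esub>)"
      using fd lin_map_closed[OF exact_complexD(1)[OF d]] by (auto simp: compose_def fun_eq_iff)
    ultimately obtain g where g: "g \<in> mod_hom R (P (n + 2)) Q"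
      "restrict f (carrier (P (n + 1))) = compose (carrier (P (n + 1))) g (d (n + 1))"
      using L unfolding Hom_exact_def by blast
    have "g (d (n + 1) u) = f u" if "u \<in> carrier (P (n + 1))" for u
      using fun_cong[OF g(2), of u] that by (simp add: compose_def)
    then show "\<exists>g. lin_map R (P (n + 2)) Q g \<and> (\<forall>u\<in>carrier (P (n + 1)). g (d (n + 1) u) = f u)"
      using g(1) by (auto simp: mod_hom_iff)
  qed
next
  assume R: ?R
  show ?L
    unfolding Hom_exact_def
  proof (intro allI subset_antisym subsetI)
    fix n f
    assume "f \<in> (\<lambda>g. compose (carrier (P (n + 1))) g (d (n + 1))) ` mod_hom R (P (n + 2)) Q"
    then obtain g where g: "lin_map R (P (n + 2)) Q g" "f = compose (carrier (P (n + 1))) g (d (n + 1))"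
      by (auto simp: mod_hom_iff)
    have lin: "lin_map R (P (n + 1)) Q (\<lambda>u. g (d (n + 1) u))"
      using exact_complexD(1)[OF d, of "n + 1"] by (intro lin_map_compose[OF _ g(1)]) (simp add: add.assoc)
    have "g (d (n + 1) (d n u)) = \<zero>\<^bsub>Q\<^esub>" if "u \<in> carrier (P n)" for u
    proof -
      have "d n u \<in> {u \<in> carrier (P (n + 1)). d (n + 1) u = \<zero>\<^bsub>P (n + 2)\<^esub>}"
        using exact_complexD(2)[OF d, of n] that by blast
      then show ?thesis using lin_map_zero[OF P Q g(1)] by simp
    qed
    moreover have "d n u \<in> carrier (P (n + 1))" if "u \<in> carrier (P n)" for u
      using lin_map_closed[OF exact_complexD(1)[OF d]] that by blast
    ultimately show "f \<in> {f \<in> mod_hom R (P (n + 1)) Q. compose (carrier (P n)) f (d n) = (\<lambda>x\<in>carrier (P n). \<zero>\<^bsub>Q\<^esub>)}"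
      using restrict_mod_hom[OF P lin] unfolding g(2) by (auto simp: compose_def)
  next
    fix n f
    assume "f \<in> {f \<in> mod_hom R (P (n + 1)) Q. compose (carrier (P n)) f (d n) = (\<lambda>x\<in>carrier (P n). \<zero>\<^bsub>Q\<^esub>)}"
    then have f: "f \<in> mod_hom R (P (n + 1)) Q" "compose (carrier (P n)) f (d n) = (\<lambda>x\<in>carrier (P n). \<zero>\<^bsub>Q\<^esub>)"
      by auto
    have "f (d n u) = \<zero>\<^bsub>Q\<^esub>" if "u \<in> carrier (P n)" for u
      using fun_cong[OF f(2), of u] that by (simp add: compose_def)
    then obtain g where g: "lin_map R (P (n + 2)) Q g" "\<And>u. u\<in>carrier (P (n + 1)) \<Longrightarrow> g (d (n + 1) u) = f u"
      using R f(1) unfolding mod_hom_iff by blast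
    have "d (n + 1) u \<in> carrier (P (n + 2))" if "u \<in> carrier (P (n + 1))" for u
      using lin_map_closed[OF exact_complexD(1)[OF d, of "n + 1"]] that by (simp add: add.assoc)
    then have "f = compose (carrier (P (n + 1))) (restrict g (carrier (P (n + 2)))) (d (n + 1))"
      using g(2) f(1) by (auto simp: compose_def fun_eq_iff mod_hom_iff extensional_def)
    then show "f \<in> (\<lambda>g. compose (carrier (P (n + 1))) g (d (n + 1))) ` mod_hom R (P (n + 2)) Q"
      using restrict_mod_hom[OF P g(1)] by blast
  qed
qed


text \<open>The data witnessing that \<open>M\<close> is Gorenstein projective: a totally acyclic complex \<open>(P, d)\<close> of projective
  modules and an embedding \<open>j\<close> of \<open>M\<close> onto the kernel of \<open>d 0\<close>.\<close>
definition complete_resolution ::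
    "('u set \<Rightarrow> bool) \<Rightarrow> ('a, 'k) ring_scheme \<Rightarrow> ('a, 'u) module \<Rightarrow> (int \<Rightarrow> ('a, 'u) module)
      \<Rightarrow> (int \<Rightarrow> 'u \<Rightarrow> 'u) \<Rightarrow> ('u \<Rightarrow> 'u) \<Rightarrow> bool" where
  "complete_resolution small R M P d j \<longleftrightarrow>
     (\<forall>n. P n \<in> left_modules small R \<and> projective small R (P n)) \<and>
     (\<forall>n. lin_map R (P n) (P (n + 1)) (d n)) \<and>
     (\<forall>n. d n ` carrier (P n) = {u \<in> carrier (P (n + 1)). d (n + 1) u = \<zero>\<^bsub>P (n + 2)\<^esub>}) \<and>
     lin_map R M (P 0) j \<and> inj_on j (carrier M) \<and>
     j ` carrier M = {u \<in> carrier (P 0). d 0 u = \<zero>\<^bsub>P 1\<^esub>} \<and>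
     (\<forall>Q\<in>left_modules small R. projective small R Q \<longrightarrow>
       (\<forall>n f. lin_map R (P (n + 1)) Q f \<longrightarrow> (\<forall>u\<in>carrier (P n). f (d n u) = \<zero>\<^bsub>Q\<^esub>) \<longrightarrow>
         (\<exists>g. lin_map R (P (n + 2)) Q g \<and> (\<forall>u\<in>carrier (P (n + 1)). g (d (n + 1) u) = f u))))"

lemma complete_resolutionI:
  assumes "\<And>n. P n \<in> left_modules small R" "\<And>n. projective small R (P n)"
    and "\<And>n. lin_map R (P n) (P (n + 1)) (d n)"
    and "\<And>n. d n ` carrier (P n) = {u \<in> carrier (P (n + 1)). d (n + 1) u = \<zero>\<^bsub>P (n + 2)\<^esub>}"
    and "lin_map R M (P 0) j" "inj_on j (carrier M)"
    and "j ` carrier M = {u \<in> carrier (P 0). d 0 u = \<zero>\<^bsub>P 1\<^esub>}"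
    and "\<And>Q n f. \<lbrakk>Q \<in> left_modules small R; projective small R Q; lin_map R (P (n + 1)) Q f;
        \<And>u. u \<in> carrier (P n) \<Longrightarrow> f (d n u) = \<zero>\<^bsub>Q\<^esub>\<rbrakk> \<Longrightarrow>
        \<exists>g. lin_map R (P (n + 2)) Q g \<and> (\<forall>u\<in>carrier (P (n + 1)). g (d (n + 1) u) = f u)"
  shows "complete_resolution small R M P d j"
  unfolding complete_resolution_def
  by (intro conjI allI ballI impI assms(1-7)) (rule assms(8); blast)

lemma complete_resolutionD:
  assumes "complete_resolution small R M P d j"
  shows "P n \<in> left_modules small R" "projective small R (P n)"
    and "lin_map R (P n) (P (n + 1)) (d n)"
    and "d n ` carrier (P n) = {u \<in> carrier (P (n + 1)). d (n + 1) u = \<zero>\<^bsub>P (n + 2)\<^esub>}"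
    and "lin_map R M (P 0) j" "inj_on j (carrier M)"
    and "j ` carrier M = {u \<in> carrier (P 0). d 0 u = \<zero>\<^bsub>P 1\<^esub>}"
    and "\<lbrakk>Q \<in> left_modules small R; projective small R Q; lin_map R (P (n + 1)) Q f;
        \<And>u. u \<in> carrier (P n) \<Longrightarrow> f (d n u) = \<zero>\<^bsub>Q\<^esub>\<rbrakk> \<Longrightarrow>
        \<exists>g. lin_map R (P (n + 2)) Q g \<and> (\<forall>u\<in>carrier (P (n + 1)). g (d (n + 1) u) = f u)"
  using assms[unfolded complete_resolution_def] by (elim conjE; simp)+

lemma gorenstein_projectives_iff:
  "M \<in> gorenstein_projectives small R \<longleftrightarrow>
     M \<in> left_modules small R \<and> (\<exists>P d j. complete_resolution small R M P d j)"
proof (intro iffI conjI)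
  assume GP: "M \<in> gorenstein_projectives small R"
  then show "M \<in> left_modules small R" by (simp add: gorenstein_projectives_def)
  from GP obtain P d where P: "\<And>n. P n \<in> left_modules small R" "\<And>n. projective small R (P n)"
    and d: "exact_complex R P d" and iso: "mod_iso R M (mod_ker (P 0) (P 1) (d 0))"
    and hom: "\<And>Q. \<lbrakk>Q \<in> left_modules small R; projective small R Q\<rbrakk> \<Longrightarrow> Hom_exact R P d Q"
    unfolding gorenstein_projectives_def by blast
  have mod: "left_module R (P n)" for n
    using P(1) by (auto simp: left_modules_def)
  from iso obtain j where j: "j \<in> mod_hom R M (mod_ker (P 0) (P 1) (d 0))"
    "bij_betw j (carrier M) (carrier (mod_ker (P 0) (P 1) (d 0)))"
    unfolding mod_iso_def by blast
  have "complete_resolution small R M P d j"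
  proof (rule complete_resolutionI[OF P exact_complexD[OF d]])
    show "lin_map R M (P 0) j"
      using j(1) by (auto simp: mod_hom_iff lin_map_def mod_ker_def)
    show "inj_on j (carrier M)" "j ` carrier M = {u \<in> carrier (P 0). d 0 u = \<zero>\<^bsub>P 1\<^esub>}"
      using j(2) by (auto simp: bij_betw_def mod_ker_def)
    fix Q n f
    assume Q: "Q \<in> left_modules small R" "projective small R Q"
      and f: "lin_map R (P (n + 1)) Q f" "\<And>u. u \<in> carrier (P n) \<Longrightarrow> f (d n u) = \<zero>\<^bsub>Q\<^esub>"
    have "left_module R Q" using Q by (simp add: left_modules_def)
    then show "\<exists>g. lin_map R (P (n + 2)) Q g \<and> (\<forall>u\<in>carrier (P (n + 1)). g (d (n + 1) u) = f u)"
      using hom[OF Q] f unfolding Hom_exact_iff[OF mod \<open>left_module R Q\<close> d] by blast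
  qed
  then show "\<exists>P d j. complete_resolution small R M P d j" by blast
next
  assume R: "M \<in> left_modules small R \<and> (\<exists>P d j. complete_resolution small R M P d j)"
  then obtain P d j where res: "complete_resolution small R M P d j" by blast
  define D where "D n = restrict (d n) (carrier (P n))" for n
  note P = complete_resolutionD(1,2)[OF res] and j = complete_resolutionD(5-7)[OF res]
  have mod: "left_module R (P n)" for n
    using P(1) by (auto simp: left_modules_def)
  have D: "exact_complex R P D"
    unfolding D_def using mod complete_resolutionD(3,4)[OF res] by (rule exact_complexI)
  have "Hom_exact R P D Q" if Q: "Q \<in> left_modules small R" "projective small R Q" for Q
  proof -
    have "left_module R Q" using Q by (simp add: left_modules_def)
    then show ?thesis
      unfolding Hom_exact_iff[OF mod \<open>left_module R Q\<close> D]
      using complete_resolutionD(8)[OF res Q] by (simp add: D_def)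
  qed
  moreover have "mod_iso R M (mod_ker (P 0) (P 1) (D 0))"
    unfolding mod_iso_def
  proof
    have carr: "carrier (mod_ker (P 0) (P 1) (D 0)) = j ` carrier M"
      by (auto simp: mod_ker_def D_def j(3))
    have "lin_map R M (mod_ker (P 0) (P 1) (D 0)) j"
      using j(1) unfolding lin_map_def carr by (auto simp: mod_ker_def)
    then show "restrict j (carrier M) \<in> mod_hom R M (mod_ker (P 0) (P 1) (D 0))"
      using R by (intro restrict_mod_hom) (auto simp: left_modules_def)
    show "bij_betw (restrict j (carrier M)) (carrier M) (carrier (mod_ker (P 0) (P 1) (D 0)))"
      unfolding carr using j(2) by (auto simp: bij_betw_def inj_on_def)
  qed
  ultimately show "M \<in> gorenstein_projectives small R"
    using R P D unfolding gorenstein_projectives_def by blast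
qed

section \<open>Frobenius systems and traces\<close>

text \<open>Frobenius homomorphism \<open>E\<close> and dual bases \<open>x a\<close> and \<open>a\<close>, for \<open>a \<in> A\<close>. The second basis is indexed by
  itself: it is a finite set of generators of \<open>R\<close> as a left \<open>S\<close>-module.\<close>
locale frobenius_system = R?: ring R + subring S R
  for S :: "'a set" and R :: "('a, 'k) ring_scheme" (structure) +
  fixes A :: "'a set" and x :: "'a \<Rightarrow> 'a" and E :: "'a \<Rightarrow> 'a"
  assumes finite_A: "finite A"
    and A_carrier: "A \<subseteq> carrier R"
    and x_carrier: "x \<in> A \<rightarrow> carrier R"
    and E_closed: "r \<in> carrier R \<Longrightarrow> E r \<in> S"
    and E_add: "\<lbrakk>r \<in> carrier R; r' \<in> carrier R\<rbrakk> \<Longrightarrow> E (r \<oplus> r') = E r \<oplus> E r'"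
    and E_left: "\<lbrakk>s \<in> S; r \<in> carrier R\<rbrakk> \<Longrightarrow> E (s \<otimes> r) = s \<otimes> E r"
    and E_right: "\<lbrakk>s \<in> S; r \<in> carrier R\<rbrakk> \<Longrightarrow> E (r \<otimes> s) = E r \<otimes> s"
    and left_expansion: "r \<in> carrier R \<Longrightarrow> (\<Oplus>a\<in>A. E (r \<otimes> x a) \<otimes> a) = r"
    and right_expansion: "r \<in> carrier R \<Longrightarrow> (\<Oplus>a\<in>A. x a \<otimes> E (a \<otimes> r)) = r"
begin

abbreviation S_ring :: "('a, 'k) ring_scheme" where
  "S_ring \<equiv> R\<lparr>carrier := S\<rparr>"

lemma a_carrier [simp]: "a \<in> A \<Longrightarrow> a \<in> carrier R"
  and x_in_carrier [simp]: "a \<in> A \<Longrightarrow> x a \<in> carrier R"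
  and E_carrier [simp]: "r \<in> carrier R \<Longrightarrow> E r \<in> carrier R"
  and S_carrier [simp]: "s \<in> S \<Longrightarrow> s \<in> carrier R"
  using A_carrier x_carrier E_closed subset by auto

lemma subring_S: "subring S R"
  by (rule subring_axioms)

lemma restrict_lin_map: "lin_map R M N f \<Longrightarrow> lin_map S_ring M N f"
  using lin_map_subring subset by blast

definition trace ::
    "('a, 'm, 'z) module_scheme \<Rightarrow> ('a, 'n, 'w) module_scheme \<Rightarrow> ('m \<Rightarrow> 'n) \<Rightarrow> 'm \<Rightarrow> 'n" where
  "trace M N h u = (\<Oplus>\<^bsub>N\<^esub>a\<in>A. x a \<odot>\<^bsub>N\<^esub> h (a \<odot>\<^bsub>M\<^esub> u))"

lemma trace_term_closed:
  assumes "left_module R M" "left_module R N" "\<And>v. v \<in> carrier M \<Longrightarrow> h v \<in> carrier N" "u \<in> carrier M" "a \<in> A"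
  shows "x a \<odot>\<^bsub>N\<^esub> h (a \<odot>\<^bsub>M\<^esub> u) \<in> carrier N"
proof -
  interpret M: left_module R M by fact
  interpret N: left_module R N by fact
  show ?thesis using assms by (simp add: M.smult_closed N.smult_closed)
qed

lemma trace_closed:
  assumes "left_module R M" "left_module R N" "\<And>v. v \<in> carrier M \<Longrightarrow> h v \<in> carrier N" "u \<in> carrier M"
  shows "trace M N h u \<in> carrier N"
proof -
  interpret N: left_module R N by fact
  show ?thesis
    unfolding trace_def using trace_term_closed[OF assms] by (intro N.M.finsum_closed) auto
qed

lemma trace_cong:
  assumes "left_module R M" "left_module R N" "\<And>v. v \<in> carrier M \<Longrightarrow> h v \<in> carrier N"
    and "\<And>v. v \<in> carrier M \<Longrightarrow> h v = h' v" "u \<in> carrier M"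
  shows "trace M N h u = trace M N h' u"
proof -
  interpret M: left_module R M by fact
  interpret N: left_module R N by fact
  show ?thesis
    unfolding trace_def using trace_term_closed[OF assms(1-3,5)] assms(4,5)
    by (intro N.M.finsum_cong') (auto simp: M.smult_closed)
qed

lemma trace_zero:
  assumes "left_module R M" "left_module R N" "\<And>v. v \<in> carrier M \<Longrightarrow> h v = \<zero>\<^bsub>N\<^esub>" "u \<in> carrier M"
  shows "trace M N h u = \<zero>\<^bsub>N\<^esub>"
proof -
  interpret M: left_module R M by fact
  interpret N: left_module R N by fact
  have "r \<odot>\<^bsub>N\<^esub> \<zero>\<^bsub>N\<^esub> = \<zero>\<^bsub>N\<^esub>" if "r \<in> carrier R" for r
    using additive_zero[of N N "\<lambda>v. r \<odot>\<^bsub>N\<^esub> v"] that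
    by (simp add: N.smult_closed N.smult_r_distr N.M.abelian_group_axioms)
  then have "trace M N h u = (\<Oplus>\<^bsub>N\<^esub>a\<in>A. \<zero>\<^bsub>N\<^esub>)"
    unfolding trace_def using assms(3,4) by (intro N.M.finsum_cong') (auto simp: M.smult_closed)
  then show ?thesis by (simp add: N.M.finsum_zero)
qed

lemma trace_lin_map:
  assumes M: "left_module R M" and N: "left_module R N" and h: "lin_map S_ring M N h"
  shows "lin_map R M N (trace M N h)"
proof -
  interpret M: left_module R M by fact
  interpret N: left_module R N by fact
  note hc = lin_map_closed[OF h] and ha = lin_map_add[OF h]
  have hs: "h (s \<odot>\<^bsub>M\<^esub> u) = s \<odot>\<^bsub>N\<^esub> h u" if "s \<in> S" "u \<in> carrier M" for s u
    using lin_map_smult[OF h] that by simp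
  note simps = M.smult_closed N.smult_closed hc
  show ?thesis
  proof (rule lin_mapI)
    fix u assume "u \<in> carrier M"
    then show "trace M N h u \<in> carrier N" by (intro trace_closed M N hc)
  next
    fix u v assume u: "u \<in> carrier M" and v: "v \<in> carrier M"
    have "trace M N h (u \<oplus>\<^bsub>M\<^esub> v) =
      (\<Oplus>\<^bsub>N\<^esub>a\<in>A. x a \<odot>\<^bsub>N\<^esub> h (a \<odot>\<^bsub>M\<^esub> u) \<oplus>\<^bsub>N\<^esub> x a \<odot>\<^bsub>N\<^esub> h (a \<odot>\<^bsub>M\<^esub> v))"
      unfolding trace_def using u v
      by (intro N.M.finsum_cong') (auto simp: simps M.smult_r_distr N.smult_r_distr ha)
    also have "\<dots> = trace M N h u \<oplus>\<^bsub>N\<^esub> trace M N h v"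
      unfolding trace_def using u v by (intro N.M.finsum_addf) (auto simp: simps)
    finally show "trace M N h (u \<oplus>\<^bsub>M\<^esub> v) = trace M N h u \<oplus>\<^bsub>N\<^esub> trace M N h v" .
  next
    fix r u assume r: "r \<in> carrier R" and u: "u \<in> carrier M"
    \<comment> \<open>The sum over \<open>x a \<otimes> a r\<close> equals the sum over \<open>r x b \<otimes> b\<close>: expand \<open>a r\<close> in the basis \<open>b\<close>, move
      the coefficients, which lie in \<open>S\<close>, across \<open>h\<close>, and collect them by the other expansion.\<close>
    have 1: "h (a \<odot>\<^bsub>M\<^esub> (r \<odot>\<^bsub>M\<^esub> u)) = (\<Oplus>\<^bsub>N\<^esub>b\<in>A. E (a \<otimes> r \<otimes> x b) \<odot>\<^bsub>N\<^esub> h (b \<odot>\<^bsub>M\<^esub> u))" if a: "a \<in> A" for a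
    proof -
      have "a \<odot>\<^bsub>M\<^esub> (r \<odot>\<^bsub>M\<^esub> u) = (\<Oplus>b\<in>A. E (a \<otimes> r \<otimes> x b) \<otimes> b) \<odot>\<^bsub>M\<^esub> u"
        using a r u by (simp add: left_expansion M.smult_assoc)
      also have "\<dots> = (\<Oplus>\<^bsub>M\<^esub>b\<in>A. (E (a \<otimes> r \<otimes> x b) \<otimes> b) \<odot>\<^bsub>M\<^esub> u)"
        using a r u finite_A by (intro M.finsum_smult) auto
      finally have "h (a \<odot>\<^bsub>M\<^esub> (r \<odot>\<^bsub>M\<^esub> u)) = (\<Oplus>\<^bsub>N\<^esub>b\<in>A. h ((E (a \<otimes> r \<otimes> x b) \<otimes> b) \<odot>\<^bsub>M\<^esub> u))"
        using a r u finite_A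
        by (simp add: lin_map_finsum[OF M.restrict_scalars[OF subring_S] N.restrict_scalars[OF subring_S] h]
            Pi_iff M.smult_closed)
      also have "\<dots> = (\<Oplus>\<^bsub>N\<^esub>b\<in>A. E (a \<otimes> r \<otimes> x b) \<odot>\<^bsub>N\<^esub> h (b \<odot>\<^bsub>M\<^esub> u))"
        using a r u by (intro N.M.finsum_cong') (auto simp: simps M.smult_assoc hs E_closed)
      finally show ?thesis .
    qed
    have "trace M N h (r \<odot>\<^bsub>M\<^esub> u)
        = (\<Oplus>\<^bsub>N\<^esub>a\<in>A. \<Oplus>\<^bsub>N\<^esub>b\<in>A. (x a \<otimes> E (a \<otimes> (r \<otimes> x b))) \<odot>\<^bsub>N\<^esub> h (b \<odot>\<^bsub>M\<^esub> u))"
      unfolding trace_def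
    proof (intro N.M.finsum_cong')
      fix a assume a: "a \<in> A"
      have "x a \<odot>\<^bsub>N\<^esub> h (a \<odot>\<^bsub>M\<^esub> (r \<odot>\<^bsub>M\<^esub> u)) =
          (\<Oplus>\<^bsub>N\<^esub>b\<in>A. x a \<odot>\<^bsub>N\<^esub> (E (a \<otimes> r \<otimes> x b) \<odot>\<^bsub>N\<^esub> h (b \<odot>\<^bsub>M\<^esub> u)))"
        unfolding 1[OF a] using a r u finite_A by (intro N.smult_finsum) (auto simp: simps)
      also have "\<dots> = (\<Oplus>\<^bsub>N\<^esub>b\<in>A. (x a \<otimes> E (a \<otimes> (r \<otimes> x b))) \<odot>\<^bsub>N\<^esub> h (b \<odot>\<^bsub>M\<^esub> u))"
        using a r u by (intro N.M.finsum_cong') (auto simp: simps N.smult_assoc m_assoc)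
      finally show "x a \<odot>\<^bsub>N\<^esub> h (a \<odot>\<^bsub>M\<^esub> (r \<odot>\<^bsub>M\<^esub> u)) =
          (\<Oplus>\<^bsub>N\<^esub>b\<in>A. (x a \<otimes> E (a \<otimes> (r \<otimes> x b))) \<odot>\<^bsub>N\<^esub> h (b \<odot>\<^bsub>M\<^esub> u))" .
    qed (use r u in \<open>auto simp: simps intro!: N.M.finsum_closed\<close>)
    also have "\<dots> = (\<Oplus>\<^bsub>N\<^esub>b\<in>A. \<Oplus>\<^bsub>N\<^esub>a\<in>A. (x a \<otimes> E (a \<otimes> (r \<otimes> x b))) \<odot>\<^bsub>N\<^esub> h (b \<odot>\<^bsub>M\<^esub> u))"
      using r u finite_A by (intro N.M.finsum_swap) (auto simp: simps)
    also have "\<dots> = (\<Oplus>\<^bsub>N\<^esub>b\<in>A. r \<odot>\<^bsub>N\<^esub> (x b \<odot>\<^bsub>N\<^esub> h (b \<odot>\<^bsub>M\<^esub> u)))"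
    proof (intro N.M.finsum_cong')
      fix b assume b: "b \<in> A"
      have "(\<Oplus>\<^bsub>N\<^esub>a\<in>A. (x a \<otimes> E (a \<otimes> (r \<otimes> x b))) \<odot>\<^bsub>N\<^esub> h (b \<odot>\<^bsub>M\<^esub> u))
          = (\<Oplus>a\<in>A. x a \<otimes> E (a \<otimes> (r \<otimes> x b))) \<odot>\<^bsub>N\<^esub> h (b \<odot>\<^bsub>M\<^esub> u)"
        using b r u finite_A by (intro N.finsum_smult[symmetric]) (auto simp: simps)
      then show "(\<Oplus>\<^bsub>N\<^esub>a\<in>A. (x a \<otimes> E (a \<otimes> (r \<otimes> x b))) \<odot>\<^bsub>N\<^esub> h (b \<odot>\<^bsub>M\<^esub> u)) = r \<odot>\<^bsub>N\<^esub> (x b \<odot>\<^bsub>N\<^esub> h (b \<odot>\<^bsub>M\<^esub> u))"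
        using b r u by (simp add: right_expansion N.smult_assoc simps)
    qed (use r u in \<open>auto simp: simps\<close>)
    also have "\<dots> = r \<odot>\<^bsub>N\<^esub> trace M N h u"
      unfolding trace_def using r u finite_A by (intro N.smult_finsum[symmetric]) (auto simp: simps)
    finally show "trace M N h (r \<odot>\<^bsub>M\<^esub> u) = r \<odot>\<^bsub>N\<^esub> trace M N h u" .
  qed
qed

lemma trace_post_compose:
  assumes M: "left_module R M" and N: "left_module R N" and L: "left_module R L"
    and g: "lin_map R N L g" and h: "\<And>v. v \<in> carrier M \<Longrightarrow> h v \<in> carrier N" and u: "u \<in> carrier M"
  shows "g (trace M N h u) = trace M L (\<lambda>v. g (h v)) u"
proof -
  interpret M: left_module R M by fact
  interpret N: left_module R N by fact
  interpret L: left_module R L by fact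
  have "g (trace M N h u) = (\<Oplus>\<^bsub>L\<^esub>a\<in>A. g (x a \<odot>\<^bsub>N\<^esub> h (a \<odot>\<^bsub>M\<^esub> u)))"
    unfolding trace_def using trace_term_closed[OF M N h u] finite_A by (intro lin_map_finsum[OF N L g]) auto
  also have "\<dots> = trace M L (\<lambda>v. g (h v)) u"
    unfolding trace_def using u
    by (intro L.M.finsum_cong') (auto simp: lin_map_smult[OF g] lin_map_closed[OF g] h M.smult_closed L.smult_closed)
  finally show ?thesis .
qed

lemma trace_pre_compose:
  assumes K: "left_module R K" and M: "left_module R M" and N: "left_module R N"
    and g: "lin_map R K M g" and h: "\<And>v. v \<in> carrier M \<Longrightarrow> h v \<in> carrier N" and u: "u \<in> carrier K"
  shows "trace M N h (g u) = trace K N (\<lambda>v. h (g v)) u"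
proof -
  interpret K: left_module R K by fact
  interpret M: left_module R M by fact
  interpret N: left_module R N by fact
  show ?thesis
    unfolding trace_def using u
    by (intro N.M.finsum_cong') (auto simp: lin_map_smult[OF g] lin_map_closed[OF g] h M.smult_closed N.smult_closed)
qed

text \<open>Up to isomorphism \<open>C\<close> is \<open>R \<otimes>\<^sub>S N\<close> with \<open>\<eta> n = 1 \<otimes> n\<close> and \<open>\<epsilon> (r \<otimes> n) = E r n\<close>, and likewise
  \<open>Hom\<^sub>S(R, N)\<close> with \<open>\<epsilon>\<close> evaluation at 1. Thus \<open>\<epsilon>\<close> is the counit of the adjunction between restriction
  and coinduction, and \<open>\<eta>\<close> the unit of that between induction and restriction.\<close>
definition induced ::
    "('a, 'n, 'w) module_scheme \<Rightarrow> ('a, 'm, 'z) module_scheme \<Rightarrow> ('m \<Rightarrow> 'n) \<Rightarrow> ('n \<Rightarrow> 'm) \<Rightarrow> bool" where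
  "induced N C \<epsilon> \<eta> \<longleftrightarrow> left_module S_ring N \<and> left_module R C \<and>
     lin_map S_ring C N \<epsilon> \<and> lin_map S_ring N C \<eta> \<and>
     (\<forall>r\<in>carrier R. \<forall>n\<in>carrier N. \<epsilon> (r \<odot>\<^bsub>C\<^esub> \<eta> n) = E r \<odot>\<^bsub>N\<^esub> n) \<and>
     (\<forall>u\<in>carrier C. trace C C (\<lambda>v. \<eta> (\<epsilon> v)) u = u)"

context
  fixes N C \<epsilon> \<eta>
  assumes ind: "induced N C \<epsilon> \<eta>"
begin

lemma induced_modules: "left_module S_ring N" "left_module R C"
  and induced_lin_maps: "lin_map S_ring C N \<epsilon>" "lin_map S_ring N C \<eta>"
  and induced_unit: "\<lbrakk>r \<in> carrier R; n \<in> carrier N\<rbrakk> \<Longrightarrow> \<epsilon> (r \<odot>\<^bsub>C\<^esub> \<eta> n) = E r \<odot>\<^bsub>N\<^esub> n"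
  and induced_trace: "u \<in> carrier C \<Longrightarrow> trace C C (\<lambda>v. \<eta> (\<epsilon> v)) u = u"
  using ind by (auto simp: induced_def)

lemma induced_closed [simp]: "u \<in> carrier C \<Longrightarrow> \<epsilon> u \<in> carrier N" "n \<in> carrier N \<Longrightarrow> \<eta> n \<in> carrier C"
  using ind by (auto simp: induced_def dest: lin_map_closed)

text \<open>The left side is the sum of all \<open>E (x a) f(a u) = f (E (x a) a u)\<close>, which the expansion of 1 collapses.\<close>
lemma induced_right_adjoint:
  assumes X: "left_module R X" and f: "lin_map S_ring X N f" and u: "u \<in> carrier X"
  shows "\<epsilon> (trace X C (\<lambda>v. \<eta> (f v)) u) = f u"
proof -
  interpret X: left_module R X by fact
  interpret C: left_module R C by (rule induced_modules)
  interpret N: left_module S_ring N by (rule induced_modules)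
  note X' = X.restrict_scalars[OF subring_S] and C' = C.restrict_scalars[OF subring_S]
  have Ef: "E (x a) \<odot>\<^bsub>N\<^esub> f (a \<odot>\<^bsub>X\<^esub> u) = f ((E (\<one> \<otimes> x a) \<otimes> a) \<odot>\<^bsub>X\<^esub> u)" if "a \<in> A" for a
    using that u lin_map_smult[OF f, of "E (x a)"] by (simp add: X.smult_assoc X.smult_closed E_closed)
  have "\<epsilon> (trace X C (\<lambda>v. \<eta> (f v)) u) = (\<Oplus>\<^bsub>N\<^esub>a\<in>A. \<epsilon> (x a \<odot>\<^bsub>C\<^esub> \<eta> (f (a \<odot>\<^bsub>X\<^esub> u))))"
    unfolding trace_def using u finite_A lin_map_closed[OF f]
    by (intro lin_map_finsum[OF C' induced_modules(1) induced_lin_maps(1)]) (auto simp: X.smult_closed C.smult_closed)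
  also have "\<dots> = (\<Oplus>\<^bsub>N\<^esub>a\<in>A. f ((E (\<one> \<otimes> x a) \<otimes> a) \<odot>\<^bsub>X\<^esub> u))"
  proof (intro N.M.finsum_cong')
    fix a assume a: "a \<in> A"
    then have "\<epsilon> (x a \<odot>\<^bsub>C\<^esub> \<eta> (f (a \<odot>\<^bsub>X\<^esub> u))) = E (x a) \<odot>\<^bsub>N\<^esub> f (a \<odot>\<^bsub>X\<^esub> u)"
      using u lin_map_closed[OF f] by (intro induced_unit) (auto simp: X.smult_closed)
    then show "\<epsilon> (x a \<odot>\<^bsub>C\<^esub> \<eta> (f (a \<odot>\<^bsub>X\<^esub> u))) = f ((E (\<one> \<otimes> x a) \<otimes> a) \<odot>\<^bsub>X\<^esub> u)"
      using Ef[OF a] by simp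
  qed (use u lin_map_closed[OF f] in \<open>auto simp: X.smult_closed\<close>)
  also have "\<dots> = f (\<Oplus>\<^bsub>X\<^esub>a\<in>A. (E (\<one> \<otimes> x a) \<otimes> a) \<odot>\<^bsub>X\<^esub> u)"
    using u finite_A by (intro lin_map_finsum[OF X' induced_modules(1) f, symmetric]) (auto simp: X.smult_closed)
  also have "\<dots> = f ((\<Oplus>a\<in>A. E (\<one> \<otimes> x a) \<otimes> a) \<odot>\<^bsub>X\<^esub> u)"
    using u finite_A by (subst X.finsum_smult) auto
  also have "\<dots> = f u"
    using u by (simp only: left_expansion R.one_closed X.smult_one)
  finally show ?thesis .
qed

text \<open>Here the sum is that of all \<open>x a E(a) f(n)\<close>, collapsed by the other expansion of 1.\<close>
lemma induced_left_adjoint: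
  assumes X: "left_module R X" and f: "lin_map S_ring N X f" and n: "n \<in> carrier N"
  shows "trace C X (\<lambda>v. f (\<epsilon> v)) (\<eta> n) = f n"
proof -
  interpret X: left_module R X by fact
  have "trace C X (\<lambda>v. f (\<epsilon> v)) (\<eta> n) = (\<Oplus>\<^bsub>X\<^esub>a\<in>A. (x a \<otimes> E (a \<otimes> \<one>)) \<odot>\<^bsub>X\<^esub> f n)"
    unfolding trace_def
  proof (intro X.M.finsum_cong')
    fix a assume a: "a \<in> A"
    have "f (E a \<odot>\<^bsub>N\<^esub> n) = E a \<odot>\<^bsub>X\<^esub> f n"
      using a n lin_map_smult[OF f] by (simp add: E_closed)
    then show "x a \<odot>\<^bsub>X\<^esub> f (\<epsilon> (a \<odot>\<^bsub>C\<^esub> \<eta> n)) = (x a \<otimes> E (a \<otimes> \<one>)) \<odot>\<^bsub>X\<^esub> f n"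
      using a n lin_map_closed[OF f] by (simp add: induced_unit X.smult_assoc)
  qed (use n lin_map_closed[OF f] in \<open>auto simp: X.smult_closed\<close>)
  also have "\<dots> = (\<Oplus>a\<in>A. x a \<otimes> E (a \<otimes> \<one>)) \<odot>\<^bsub>X\<^esub> f n"
    using n finite_A lin_map_closed[OF f] by (subst X.finsum_smult) auto
  also have "\<dots> = f n"
    using n lin_map_closed[OF f] by (simp only: right_expansion R.one_closed X.smult_one)
  finally show ?thesis .
qed

end

end

section \<open>Induction and Gorenstein projective modules\<close>

text \<open>A choice of small induced modules. Between \<open>S\<close>-modules and \<open>R\<close>-modules, \<open>f \<mapsto> trace (\<eta> f)\<close> and
  \<open>f \<mapsto> trace (f \<epsilon>)\<close> are the two adjunction bijections.\<close>
locale frobenius_induction = frobenius_system S R A x E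
  for S :: "'a set" and R :: "('a, 'k) ring_scheme" (structure) and A x E +
  fixes small :: "'u set \<Rightarrow> bool"
    and Ind :: "('a, 'u) module \<Rightarrow> ('a, 'u) module"
    and \<epsilon> \<eta> :: "('a, 'u) module \<Rightarrow> 'u \<Rightarrow> 'u"
  assumes Ind_induced: "N \<in> left_modules small S_ring \<Longrightarrow> induced N (Ind N) (\<epsilon> N) (\<eta> N)"
    and Ind_small: "N \<in> left_modules small S_ring \<Longrightarrow> small (carrier (Ind N))"
begin

lemma left_modulesD: "M \<in> left_modules small T \<Longrightarrow> left_module T M"
  by (simp add: left_modules_def)

lemma restrict_left_modules:
  "M \<in> left_modules small R \<Longrightarrow> M \<in> left_modules small S_ring"
  by (auto simp: left_modules_def intro: left_module.restrict_scalars subring_S)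

context
  fixes N assumes N: "N \<in> left_modules small S_ring"
begin

lemmas N_induced = Ind_induced[OF N]
lemmas Ind_module = induced_modules(2)[OF N_induced]
  and counit_lin = induced_lin_maps(1)[OF N_induced]
  and unit_lin = induced_lin_maps(2)[OF N_induced]
  and counit_closed = induced_closed(1)[OF N_induced]
  and unit_closed = induced_closed(2)[OF N_induced]

lemma Ind_left_modules: "Ind N \<in> left_modules small R"
  using Ind_module Ind_small[OF N] by (simp add: left_modules_def)

lemma unit_comp_lin:
  assumes "lin_map S_ring X N f"
  shows "lin_map S_ring X (Ind N) (\<lambda>v. \<eta> N (f v))"
  using assms unit_lin by (rule lin_map_compose)

lemma comp_counit_lin:
  assumes "lin_map S_ring N X f"
  shows "lin_map S_ring (Ind N) X (\<lambda>v. f (\<epsilon> N v))"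
  using counit_lin assms by (rule lin_map_compose)

lemma right_adjunct_lin:
  assumes "left_module R X" "lin_map S_ring X N f"
  shows "lin_map R X (Ind N) (trace X (Ind N) (\<lambda>v. \<eta> N (f v)))"
  using assms Ind_module by (intro trace_lin_map unit_comp_lin)

lemma left_adjunct_lin:
  assumes "left_module R X" "lin_map S_ring N X f"
  shows "lin_map R (Ind N) X (trace (Ind N) X (\<lambda>v. f (\<epsilon> N v)))"
  using assms Ind_module by (intro trace_lin_map comp_counit_lin)

end

definition Ind_map :: "('a, 'u) module \<Rightarrow> ('a, 'u) module \<Rightarrow> ('u \<Rightarrow> 'u) \<Rightarrow> 'u \<Rightarrow> 'u" where
  "Ind_map N N' f = trace (Ind N) (Ind N') (\<lambda>v. \<eta> N' (f (\<epsilon> N v)))"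

context
  fixes N N' f
  assumes N: "N \<in> left_modules small S_ring" and N': "N' \<in> left_modules small S_ring"
    and f: "lin_map S_ring N N' f"
begin

lemma Ind_map_lin: "lin_map R (Ind N) (Ind N') (Ind_map N N' f)"
  unfolding Ind_map_def
  by (intro left_adjunct_lin[OF N] unit_comp_lin[OF N'] f Ind_module[OF N'])

lemma counit_Ind_map: "u \<in> carrier (Ind N) \<Longrightarrow> \<epsilon> N' (Ind_map N N' f u) = f (\<epsilon> N u)"
  unfolding Ind_map_def
  by (intro induced_right_adjoint[OF Ind_induced[OF N']] Ind_module[OF N] comp_counit_lin[OF N] f)

lemma Ind_map_unit: "n \<in> carrier N \<Longrightarrow> Ind_map N N' f (\<eta> N n) = \<eta> N' (f n)"
  unfolding Ind_map_def
  by (intro induced_left_adjoint[OF Ind_induced[OF N]] Ind_module[OF N'] unit_comp_lin[OF N'] f)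

lemma counit_smult_Ind_map:
  assumes "r \<in> carrier R" "u \<in> carrier (Ind N)"
  shows "\<epsilon> N' (r \<odot>\<^bsub>Ind N'\<^esub> Ind_map N N' f u) = f (\<epsilon> N (r \<odot>\<^bsub>Ind N\<^esub> u))"
  using assms left_module.smult_closed[OF Ind_module[OF N]]
  by (simp flip: lin_map_smult[OF Ind_map_lin] add: counit_Ind_map)

text \<open>An element \<open>u\<close> of an induced module is the sum of all \<open>x a \<eta>(\<epsilon>(a u))\<close>, so it has a preimage as soon as its
  coordinates \<open>\<epsilon>(a u)\<close> have preimages under \<open>f\<close>. Surjectivity and exactness of induction follow.\<close>
lemma Ind_map_lift:
  assumes u: "u \<in> carrier (Ind N')" and im: "\<And>a. a \<in> A \<Longrightarrow> \<epsilon> N' (a \<odot>\<^bsub>Ind N'\<^esub> u) \<in> f ` carrier N"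
  shows "u \<in> Ind_map N N' f ` carrier (Ind N)"
proof -
  interpret I: left_module R "Ind N" by (rule Ind_module[OF N])
  interpret I': left_module R "Ind N'" by (rule Ind_module[OF N'])
  from im obtain m where m: "\<And>a. a \<in> A \<Longrightarrow> m a \<in> carrier N \<and> f (m a) = \<epsilon> N' (a \<odot>\<^bsub>Ind N'\<^esub> u)"
    unfolding image_iff by metis
  define v where "v = (\<Oplus>\<^bsub>Ind N\<^esub>a\<in>A. x a \<odot>\<^bsub>Ind N\<^esub> \<eta> N (m a))"
  have term_closed: "x a \<odot>\<^bsub>Ind N\<^esub> \<eta> N (m a) \<in> carrier (Ind N)" if "a \<in> A" for a
    using m[OF that] that by (simp add: I.smult_closed unit_closed[OF N])
  have v: "v \<in> carrier (Ind N)"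
    unfolding v_def using term_closed by (intro I.M.finsum_closed) auto
  have "Ind_map N N' f v = (\<Oplus>\<^bsub>Ind N'\<^esub>a\<in>A. Ind_map N N' f (x a \<odot>\<^bsub>Ind N\<^esub> \<eta> N (m a)))"
    unfolding v_def using term_closed finite_A
    by (intro lin_map_finsum[OF Ind_module[OF N] Ind_module[OF N'] Ind_map_lin]) auto
  also have "\<dots> = trace (Ind N') (Ind N') (\<lambda>v. \<eta> N' (\<epsilon> N' v)) u"
    unfolding trace_def using m u
    by (intro I'.M.finsum_cong')
      (auto simp: lin_map_smult[OF Ind_map_lin] unit_closed[OF N] unit_closed[OF N'] counit_closed[OF N']
        Ind_map_unit I'.smult_closed)
  also have "\<dots> = u"
    using u by (rule induced_trace[OF Ind_induced[OF N']])
  finally show ?thesis using v by blast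
qed

lemma Ind_map_surj:
  assumes "f ` carrier N = carrier N'"
  shows "Ind_map N N' f ` carrier (Ind N) = carrier (Ind N')"
proof -
  interpret I': left_module R "Ind N'" by (rule Ind_module[OF N'])
  show ?thesis
    using Ind_map_lift assms counit_closed[OF N'] I'.smult_closed lin_map_closed[OF Ind_map_lin]
    by (auto simp: image_subset_iff)
qed

text \<open>An element is also determined by its coordinates, and on coordinates the induced map acts as \<open>f\<close>.\<close>
lemma Ind_map_inj:
  assumes inj: "inj_on f (carrier N)"
  shows "inj_on (Ind_map N N' f) (carrier (Ind N))"
proof (rule inj_onI)
  interpret I: left_module R "Ind N" by (rule Ind_module[OF N])
  fix u v assume u: "u \<in> carrier (Ind N)" and v: "v \<in> carrier (Ind N)"
    and eq: "Ind_map N N' f u = Ind_map N N' f v"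
  have ua: "\<epsilon> N (a \<odot>\<^bsub>Ind N\<^esub> u) = \<epsilon> N (a \<odot>\<^bsub>Ind N\<^esub> v)" if a: "a \<in> A" for a
  proof (rule inj_onD[OF inj])
    show "f (\<epsilon> N (a \<odot>\<^bsub>Ind N\<^esub> u)) = f (\<epsilon> N (a \<odot>\<^bsub>Ind N\<^esub> v))"
      using a u v eq by (simp flip: counit_smult_Ind_map)
  qed (use a u v in \<open>auto simp: counit_closed[OF N] I.smult_closed\<close>)
  have "trace (Ind N) (Ind N) (\<lambda>v. \<eta> N (\<epsilon> N v)) u = trace (Ind N) (Ind N) (\<lambda>v. \<eta> N (\<epsilon> N v)) v"
    unfolding trace_def using u v
    by (intro I.M.finsum_cong') (auto simp: ua I.smult_closed counit_closed[OF N] unit_closed[OF N])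
  then show "u = v"
    using u v by (simp add: induced_trace[OF Ind_induced[OF N]])
qed

end

lemma Ind_map_exact:
  assumes N: "N \<in> left_modules small S_ring" and N': "N' \<in> left_modules small S_ring"
    and N'': "N'' \<in> left_modules small S_ring"
    and f: "lin_map S_ring N N' f" and g: "lin_map S_ring N' N'' g"
    and ex: "f ` carrier N = {u \<in> carrier N'. g u = \<zero>\<^bsub>N''\<^esub>}"
  shows "Ind_map N N' f ` carrier (Ind N) = {u \<in> carrier (Ind N'). Ind_map N' N'' g u = \<zero>\<^bsub>Ind N''\<^esub>}"
proof (intro subset_antisym subsetI)
  interpret I'': left_module R "Ind N''" by (rule Ind_module[OF N''])
  interpret I': left_module R "Ind N'" by (rule Ind_module[OF N'])
  have unit0: "\<eta> N'' \<zero>\<^bsub>N''\<^esub> = \<zero>\<^bsub>Ind N''\<^esub>"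
    by (rule lin_map_zero[OF left_modulesD[OF N''] I''.restrict_scalars[OF subring_S] unit_lin[OF N'']])
  have counit0: "\<epsilon> N'' \<zero>\<^bsub>Ind N''\<^esub> = \<zero>\<^bsub>N''\<^esub>"
    by (rule lin_map_zero[OF I''.restrict_scalars[OF subring_S] left_modulesD[OF N''] counit_lin[OF N'']])
  {
    fix w assume "w \<in> Ind_map N N' f ` carrier (Ind N)"
    then obtain u where u: "u \<in> carrier (Ind N)" and w: "w = Ind_map N N' f u" by blast
    have "Ind_map N' N'' g w = trace (Ind N) (Ind N'') (\<lambda>v. \<eta> N'' (g (\<epsilon> N' (Ind_map N N' f v)))) u"
      unfolding w Ind_map_def[of N' N'']
      by (rule trace_pre_compose)
        (use u in \<open>auto simp: Ind_module[OF N] Ind_module[OF N'] Ind_module[OF N''] Ind_map_lin[OF N N' f]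
          unit_closed[OF N''] counit_closed[OF N'] lin_map_closed[OF g]\<close>)
    also have "\<dots> = \<zero>\<^bsub>Ind N''\<^esub>"
    proof (rule trace_zero)
      fix v assume v: "v \<in> carrier (Ind N)"
      then have "f (\<epsilon> N v) \<in> {u \<in> carrier N'. g u = \<zero>\<^bsub>N''\<^esub>}"
        using ex counit_closed[OF N] by blast
      then show "\<eta> N'' (g (\<epsilon> N' (Ind_map N N' f v))) = \<zero>\<^bsub>Ind N''\<^esub>"
        using v by (simp add: counit_Ind_map[OF N N' f] unit0)
    qed (use u in \<open>auto simp: Ind_module[OF N] Ind_module[OF N'']\<close>)
    finally show "w \<in> {u \<in> carrier (Ind N'). Ind_map N' N'' g u = \<zero>\<^bsub>Ind N''\<^esub>}"
      using u w lin_map_closed[OF Ind_map_lin[OF N N' f]] by simp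
  next
    fix u assume "u \<in> {u \<in> carrier (Ind N'). Ind_map N' N'' g u = \<zero>\<^bsub>Ind N''\<^esub>}"
    then have u: "u \<in> carrier (Ind N')" "Ind_map N' N'' g u = \<zero>\<^bsub>Ind N''\<^esub>" by auto
    have "\<epsilon> N' (a \<odot>\<^bsub>Ind N'\<^esub> u) \<in> f ` carrier N" if a: "a \<in> A" for a
    proof -
      have "g (\<epsilon> N' (a \<odot>\<^bsub>Ind N'\<^esub> u)) = \<zero>\<^bsub>N''\<^esub>"
        using counit_smult_Ind_map[OF N' N'' g, of a u] u a by (simp add: I''.smult_zero counit0)
      then show ?thesis
        unfolding ex using u a by (simp add: counit_closed[OF N'] I'.smult_closed)
    qed
    then show "u \<in> Ind_map N N' f ` carrier (Ind N)"
      by (rule Ind_map_lift[OF N N' f u(1)])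
  }
qed

text \<open>Restriction is left adjoint to the exact functor \<open>Ind\<close>: the adjunct of \<open>f\<close> lifts along the surjection
  induced by \<open>p\<close>, and the lift is turned back into a lift of \<open>f\<close> by the counit.\<close>
lemma projective_restrict:
  assumes P: "projective small R P"
  shows "projective small S_ring P"
proof -
  have modP: "left_module R P" using P by (simp add: projective_def)
  then have modP': "left_module S_ring P"
    by (rule left_module.restrict_scalars[OF _ subring_S])
  have "\<exists>g. lin_map S_ring P M g \<and> (\<forall>u\<in>carrier P. p (g u) = f u)"
    if M: "M \<in> left_modules small S_ring" and N: "N \<in> left_modules small S_ring"
      and p: "lin_map S_ring M N p" "p ` carrier M = carrier N" and f: "lin_map S_ring P N f" for M N p f
  proof -
    obtain g where g: "lin_map R P (Ind M) g"
      "\<And>u. u \<in> carrier P \<Longrightarrow> Ind_map M N p (g u) = trace P (Ind N) (\<lambda>v. \<eta> N (f v)) u"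
      using P Ind_left_modules[OF M] Ind_left_modules[OF N] Ind_map_lin[OF M N p(1)] Ind_map_surj[OF M N p]
        right_adjunct_lin[OF N modP f] unfolding projective_iff by metis
    have "p (\<epsilon> M (g u)) = f u" if u: "u \<in> carrier P" for u
      using counit_Ind_map[OF M N p(1), of "g u"] lin_map_closed[OF g(1)] u g(2)
        induced_right_adjoint[OF Ind_induced[OF N] modP f] by simp
    moreover have "lin_map S_ring P M (\<lambda>u. \<epsilon> M (g u))"
      using restrict_lin_map[OF g(1)] counit_lin[OF M] by (rule lin_map_compose)
    ultimately show ?thesis by blast
  qed
  then show ?thesis
    unfolding projective_iff using modP' by blast
qed

text \<open>Induction is left adjoint to restriction, which preserves surjections.\<close>
lemma projective_Ind:
  assumes N: "N \<in> left_modules small S_ring" and proj: "projective small S_ring N"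
  shows "projective small R (Ind N)"
proof -
  have "\<exists>g. lin_map R (Ind N) M g \<and> (\<forall>u\<in>carrier (Ind N). p (g u) = f u)"
    if M: "M \<in> left_modules small R" and L: "L \<in> left_modules small R"
      and p: "lin_map R M L p" "p ` carrier M = carrier L" and f: "lin_map R (Ind N) L f" for M L p f
  proof -
    note mods = left_modulesD[OF M] left_modulesD[OF L] Ind_module[OF N]
    have "lin_map S_ring N L (\<lambda>n. f (\<eta> N n))"
      using unit_lin[OF N] restrict_lin_map[OF f] by (rule lin_map_compose)
    then obtain g where g: "lin_map S_ring N M g" "\<And>n. n \<in> carrier N \<Longrightarrow> p (g n) = f (\<eta> N n)"
      using proj restrict_left_modules[OF M] restrict_left_modules[OF L] restrict_lin_map[OF p(1)] p(2)
      unfolding projective_iff by metis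
    let ?g = "trace (Ind N) M (\<lambda>v. g (\<epsilon> N v))"
    have "p (?g u) = f u" if u: "u \<in> carrier (Ind N)" for u
    proof -
      have "p (?g u) = trace (Ind N) L (\<lambda>v. p (g (\<epsilon> N v))) u"
        using u lin_map_closed[OF g(1)] by (intro trace_post_compose mods p) (auto simp: counit_closed[OF N])
      also have "\<dots> = trace (Ind N) L (\<lambda>v. f (\<eta> N (\<epsilon> N v))) u"
        using u lin_map_closed[OF f] g(2)
        by (intro trace_cong mods) (auto simp: counit_closed[OF N] unit_closed[OF N])
      also have "\<dots> = f (trace (Ind N) (Ind N) (\<lambda>v. \<eta> N (\<epsilon> N v)) u)"
        using u by (intro trace_post_compose[symmetric] mods f) (auto simp: counit_closed[OF N] unit_closed[OF N])
      finally show ?thesis using induced_trace[OF Ind_induced[OF N] u] by simp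
    qed
    moreover have "lin_map R (Ind N) M ?g"
      by (intro left_adjunct_lin[OF N] mods g)
    ultimately show ?thesis by blast
  qed
  then show ?thesis
    unfolding projective_iff using Ind_module[OF N] by blast
qed

text \<open>The complex stays the same. A map from it to an \<open>S\<close>-projective \<open>Q\<close> corresponds to one to the
  \<open>R\<close>-projective module \<open>Ind Q\<close>, where it extends.\<close>
lemma gorenstein_projective_restrict:
  assumes "M \<in> gorenstein_projectives small R"
  shows "M \<in> gorenstein_projectives small S_ring"
proof -
  have M: "M \<in> left_modules small R" using assms by (simp add: gorenstein_projectives_def)
  obtain P d j where res: "complete_resolution small R M P d j"
    using assms by (auto simp: gorenstein_projectives_iff)
  note P = complete_resolutionD(1,2)[OF res] and d = complete_resolutionD(3,4)[OF res]
    and j = complete_resolutionD(5-7)[OF res] and hom = complete_resolutionD(8)[OF res]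
  note mod = left_modulesD[OF P(1)]
  have "complete_resolution small S_ring M P d j"
  proof (rule complete_resolutionI)
    fix Q n f
    assume Q: "Q \<in> left_modules small S_ring" "projective small S_ring Q"
      and f: "lin_map S_ring (P (n + 1)) Q f" and fd: "\<And>u. u \<in> carrier (P n) \<Longrightarrow> f (d n u) = \<zero>\<^bsub>Q\<^esub>"
    note I = Ind_module[OF Q(1)]
    let ?f = "trace (P (n + 1)) (Ind Q) (\<lambda>v. \<eta> Q (f v))"
    have "?f (d n u) = \<zero>\<^bsub>Ind Q\<^esub>" if u: "u \<in> carrier (P n)" for u
    proof -
      have "\<eta> Q \<zero>\<^bsub>Q\<^esub> = \<zero>\<^bsub>Ind Q\<^esub>"
        by (rule lin_map_zero[OF left_modulesD[OF Q(1)] left_module.restrict_scalars[OF I subring_S] unit_lin[OF Q(1)]])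
      then have "trace (P n) (Ind Q) (\<lambda>v. \<eta> Q (f (d n v))) u = \<zero>\<^bsub>Ind Q\<^esub>"
        using u by (intro trace_zero mod I) (auto simp: fd)
      moreover have "?f (d n u) = trace (P n) (Ind Q) (\<lambda>v. \<eta> Q (f (d n v))) u"
        using u lin_map_closed[OF f] by (intro trace_pre_compose mod I d) (auto simp: unit_closed[OF Q(1)])
      ultimately show ?thesis by simp
    qed
    then obtain g where g: "lin_map R (P (n + 2)) (Ind Q) g"
      "\<And>u. u\<in>carrier (P (n + 1)) \<Longrightarrow> g (d (n + 1) u) = ?f u"
      using hom[OF Ind_left_modules[OF Q(1)] projective_Ind[OF Q] right_adjunct_lin[OF Q(1) mod f]] by blast
    have "\<epsilon> Q (g (d (n + 1) u)) = f u" if u: "u\<in>carrier (P (n + 1))" for u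
      using g(2)[OF u] induced_right_adjoint[OF Ind_induced[OF Q(1)] mod f u] by simp
    moreover have "lin_map S_ring (P (n + 2)) Q (\<lambda>u. \<epsilon> Q (g u))"
      using restrict_lin_map[OF g(1)] counit_lin[OF Q(1)] by (rule lin_map_compose)
    ultimately show "\<exists>g. lin_map S_ring (P (n + 2)) Q g \<and> (\<forall>u\<in>carrier (P (n + 1)). g (d (n + 1) u) = f u)"
      by (intro exI[of _ "\<lambda>u. \<epsilon> Q (g u)"]) simp
  qed (use M P d j in \<open>auto simp: restrict_left_modules projective_restrict restrict_lin_map\<close>)
  then show ?thesis
    using restrict_left_modules[OF M] unfolding gorenstein_projectives_iff by blast
qed

text \<open>The complex is induced term by term. A map from it to an \<open>R\<close>-projective \<open>Q\<close> corresponds to one from the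
  original complex to \<open>Q\<close>, which is \<open>S\<close>-projective.\<close>
lemma gorenstein_projective_Ind:
  assumes "N \<in> gorenstein_projectives small S_ring"
  shows "Ind N \<in> gorenstein_projectives small R"
proof -
  have N: "N \<in> left_modules small S_ring" using assms by (simp add: gorenstein_projectives_def)
  obtain P d j where res: "complete_resolution small S_ring N P d j"
    using assms by (auto simp: gorenstein_projectives_iff)
  note P = complete_resolutionD(1,2)[OF res] and d = complete_resolutionD(3,4)[OF res]
    and j = complete_resolutionD(5-7)[OF res] and hom = complete_resolutionD(8)[OF res]
  have d0: "lin_map S_ring (P 0) (P 1) (d 0)" using d(1)[of 0] by simp
  have d1: "lin_map S_ring (P (n + 1)) (P (n + 2)) (d (n + 1))" for n using d(1)[of "n + 1"] by (simp add: add.assoc)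
  have "complete_resolution small R (Ind N) (\<lambda>n. Ind (P n)) (\<lambda>n. Ind_map (P n) (P (n + 1)) (d n))
      (Ind_map N (P 0) j)"
  proof (rule complete_resolutionI)
    show "Ind_map (P n) (P (n + 1)) (d n) ` carrier (Ind (P n)) =
        {u \<in> carrier (Ind (P (n + 1))). Ind_map (P (n + 1)) (P (n + 1 + 1)) (d (n + 1)) u = \<zero>\<^bsub>Ind (P (n + 2))\<^esub>}" for n
      using Ind_map_exact[OF P(1) P(1) P(1) d(1) d1 d(2), of n] by (simp add: add.assoc)
    show "Ind_map N (P 0) j ` carrier (Ind N) =
        {u \<in> carrier (Ind (P 0)). Ind_map (P 0) (P (0 + 1)) (d 0) u = \<zero>\<^bsub>Ind (P 1)\<^esub>}"
      using Ind_map_exact[OF N P(1) P(1) j(1) d0 j(3)] by simp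
    fix Q n f
    assume Q: "Q \<in> left_modules small R" "projective small R Q"
      and f: "lin_map R (Ind (P (n + 1))) Q f"
      and fd: "\<And>u. u \<in> carrier (Ind (P n)) \<Longrightarrow> f (Ind_map (P n) (P (n + 1)) (d n) u) = \<zero>\<^bsub>Q\<^esub>"
    note P0 = P(1)[of n] and P1 = P(1)[of "n + 1"] and P2 = P(1)[of "n + 2"]
    note mods = Ind_module[OF P1] Ind_module[OF P2] left_modulesD[OF Q(1)]
    have f': "lin_map S_ring (P (n + 1)) Q (\<lambda>v. f (\<eta> (P (n + 1)) v))"
      using unit_lin[OF P1] restrict_lin_map[OF f] by (rule lin_map_compose)
    have "f (\<eta> (P (n + 1)) (d n u)) = \<zero>\<^bsub>Q\<^esub>" if u: "u \<in> carrier (P n)" for u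
      using fd[OF unit_closed[OF P0 u]] Ind_map_unit[OF P0 P1 d(1) u] by simp
    then obtain g where g: "lin_map S_ring (P (n + 2)) Q g"
      "\<And>u. u\<in>carrier (P (n + 1)) \<Longrightarrow> g (d (n + 1) u) = f (\<eta> (P (n + 1)) u)"
      using hom[OF restrict_left_modules[OF Q(1)] projective_restrict[OF Q(2)] f'] by blast
    let ?g = "trace (Ind (P (n + 2))) Q (\<lambda>v. g (\<epsilon> (P (n + 2)) v))"
    let ?d = "Ind_map (P (n + 1)) (P (n + 2)) (d (n + 1))"
    have "?g (?d u) = f u" if u: "u \<in> carrier (Ind (P (n + 1)))" for u
    proof -
      have "?g (?d u) = trace (Ind (P (n + 1))) Q (\<lambda>v. g (\<epsilon> (P (n + 2)) (?d v))) u"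
        using u lin_map_closed[OF g(1)] by (intro trace_pre_compose mods Ind_map_lin P1 P2 d1) (auto simp: counit_closed[OF P2])
      also have "\<dots> = trace (Ind (P (n + 1))) Q (\<lambda>v. f (\<eta> (P (n + 1)) (\<epsilon> (P (n + 1)) v))) u"
        using u lin_map_closed[OF f]
        by (intro trace_cong[symmetric] mods)
          (auto simp: counit_Ind_map[OF P1 P2 d1] g(2) counit_closed[OF P1] unit_closed[OF P1])
      also have "\<dots> = f (trace (Ind (P (n + 1))) (Ind (P (n + 1))) (\<lambda>v. \<eta> (P (n + 1)) (\<epsilon> (P (n + 1)) v)) u)"
        using u by (intro trace_post_compose[symmetric] mods f) (auto simp: counit_closed[OF P1] unit_closed[OF P1])
      finally show ?thesis using induced_trace[OF Ind_induced[OF P1] u] by simp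
    qed
    moreover have "lin_map R (Ind (P (n + 2))) Q ?g"
      by (intro left_adjunct_lin P2 mods g)
    ultimately show "\<exists>g. lin_map R (Ind (P (n + 2))) Q g \<and>
        (\<forall>u\<in>carrier (Ind (P (n + 1))). g (Ind_map (P (n + 1)) (P (n + 1 + 1)) (d (n + 1)) u) = f u)"
      by (intro exI[of _ ?g]) (simp add: add.assoc)
  qed (use N P d j in \<open>auto simp: Ind_left_modules projective_Ind Ind_map_lin Ind_map_inj\<close>)
  then show ?thesis
    using Ind_left_modules[OF N] unfolding gorenstein_projectives_iff by blast
qed

text \<open>The conditions on \<open>c\<close> say that multiplication by \<open>c\<close> is \<open>S\<close>-linear with trace the identity; this is
  what a splitting of \<open>Ind X \<rightarrow> X\<close> that is natural in \<open>X\<close> amounts to.\<close>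
lemma precovering_induced:
  assumes c: "c \<in> carrier R" "\<And>s. s \<in> S \<Longrightarrow> c \<otimes> s = s \<otimes> c" "(\<Oplus>a\<in>A. x a \<otimes> (c \<otimes> a)) = \<one>"
    and pre: "precovering small S_ring (gorenstein_projectives small S_ring)"
  shows "precovering small R (gorenstein_projectives small R)"
proof -
  have sub: "gorenstein_projectives small T \<subseteq> left_modules small T" for T :: "('a, 'k) ring_scheme"
    by (auto simp: gorenstein_projectives_def)
  have "\<exists>X \<phi>. precover R (gorenstein_projectives small R) M X \<phi>" if M: "M \<in> left_modules small R" for M
  proof -
    obtain G g where "precover S_ring (gorenstein_projectives small S_ring) M G g"
      using pre restrict_left_modules[OF M] unfolding precovering_def by blast
    then have GP: "G \<in> gorenstein_projectives small S_ring" and g: "lin_map S_ring G M g"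
      and lift: "\<And>X f. \<lbrakk>X \<in> gorenstein_projectives small S_ring; lin_map S_ring X M f\<rbrakk> \<Longrightarrow>
        \<exists>h. lin_map S_ring X G h \<and> (\<forall>u\<in>carrier X. g (h u) = f u)"
      unfolding precover_iff[OF sub] mod_hom_iff by blast+
    have G: "G \<in> left_modules small S_ring" using GP sub by blast
    note mods = left_modulesD[OF M] Ind_module[OF G]
    let ?\<phi> = "trace (Ind G) M (\<lambda>v. g (\<epsilon> G v))"
    have \<phi>: "lin_map R (Ind G) M ?\<phi>"
      by (intro left_adjunct_lin G mods g)
    have "\<exists>h. lin_map R X (Ind G) h \<and> (\<forall>u\<in>carrier X. restrict ?\<phi> (carrier (Ind G)) (h u) = f u)"
      if X: "X \<in> gorenstein_projectives small R" and f: "lin_map R X M f" for X f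
    proof -
      have modX: "left_module R X" using X by (auto simp: gorenstein_projectives_def left_modules_def)
      interpret X: left_module R X by fact
      have lin_c: "lin_map S_ring X X (\<lambda>v. c \<odot>\<^bsub>X\<^esub> v)"
        using c(1,2) by (intro lin_mapI) (auto simp: X.smult_closed X.smult_r_distr simp flip: X.smult_assoc)
      have trace_c: "trace X X (\<lambda>v. c \<odot>\<^bsub>X\<^esub> v) u = u" if u: "u \<in> carrier X" for u
      proof -
        have "trace X X (\<lambda>v. c \<odot>\<^bsub>X\<^esub> v) u = (\<Oplus>\<^bsub>X\<^esub>a\<in>A. (x a \<otimes> (c \<otimes> a)) \<odot>\<^bsub>X\<^esub> u)"
          unfolding trace_def using c(1) u
          by (intro X.M.finsum_cong') (auto simp: X.smult_assoc X.smult_closed)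
        also have "\<dots> = (\<Oplus>a\<in>A. x a \<otimes> (c \<otimes> a)) \<odot>\<^bsub>X\<^esub> u"
          using c(1) u finite_A by (intro X.finsum_smult[symmetric]) auto
        finally show ?thesis using c(3) u by (simp add: X.smult_one)
      qed
      \<comment> \<open>Not \<open>f\<close> itself but \<open>f\<close> after multiplication by \<open>c\<close> is lifted: its trace is \<open>f\<close>.\<close>
      obtain h where h: "lin_map S_ring X G h" "\<And>u. u \<in> carrier X \<Longrightarrow> g (h u) = f (c \<odot>\<^bsub>X\<^esub> u)"
        using lift[OF gorenstein_projective_restrict[OF X] lin_map_compose[OF lin_c restrict_lin_map[OF f]]] by blast
      let ?h = "trace X (Ind G) (\<lambda>v. \<eta> G (h v))"
      have lin_h: "lin_map R X (Ind G) ?h"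
        by (intro right_adjunct_lin G modX h)
      have "?\<phi> (?h u) = f u" if u: "u \<in> carrier X" for u
      proof -
        have "?\<phi> (?h u) = trace X M (\<lambda>v. g (\<epsilon> G (?h v))) u"
          using u lin_map_closed[OF g] by (intro trace_pre_compose mods modX lin_h) (auto simp: counit_closed[OF G])
        also have "\<dots> = trace X M (\<lambda>v. f (c \<odot>\<^bsub>X\<^esub> v)) u"
          using u lin_map_closed[OF f] c(1)
          by (intro trace_cong[symmetric] mods modX)
            (auto simp: X.smult_closed h(2) induced_right_adjoint[OF Ind_induced[OF G] modX h(1)])
        also have "\<dots> = f (trace X X (\<lambda>v. c \<odot>\<^bsub>X\<^esub> v) u)"
          using u c(1) by (intro trace_post_compose[symmetric] mods modX f) (auto simp: X.smult_closed)
        finally show ?thesis using trace_c[OF u] by simp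
      qed
      then show ?thesis
        using lin_h lin_map_closed[OF lin_h] by (intro exI[of _ ?h]) auto
    qed
    then have "precover R (gorenstein_projectives small R) M (Ind G) (restrict ?\<phi> (carrier (Ind G)))"
      unfolding precover_iff[OF sub]
      using gorenstein_projective_Ind[OF GP] restrict_mod_hom[OF mods(2) \<phi>] by blast
    then show ?thesis by blast
  qed
  then show ?thesis unfolding precovering_def by blast
qed

end

section \<open>Small induced modules\<close>

lemma finite_power_lepoll:
  assumes "infinite Z" "finite A"
  shows "(A \<rightarrow>\<^sub>E Z) \<lesssim> Z"
  using assms(2)
proof (induction A)
  case empty
  have "{\<lambda>x. undefined} \<lesssim> Z"
    using assms(1) by (meson finite.emptyI finite.insertI finite_lepoll_infinite)
  then show ?case by simp
next
  case (insert a A)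
  have "(insert a A \<rightarrow>\<^sub>E Z) = (\<lambda>(y, g). g(a := y)) ` (Z \<times> (A \<rightarrow>\<^sub>E Z))"
    by (rule PiE_insert_eq)
  also have "\<dots> \<lesssim> Z \<times> (A \<rightarrow>\<^sub>E Z)"
    by (rule image_lepoll)
  also have "\<dots> \<lesssim> Z \<times> Z"
    by (rule times_lepoll_mono) (use insert.IH in auto)
  also have "\<dots> \<approx> Z"
    using card_of_Times_same_infinite[OF assms(1)] by (simp add: eqpoll_iff_card_of_ordIso)
  finally show ?case .
qed

text \<open>Finite powers of a small set have small copies in \<open>'u\<close>. When the set is finite, the copy is
  found inside an infinite small set.\<close>
lemma (in small_sets) small_encoding:
  assumes B: "small B" and A: "finite A" and X: "X \<lesssim> (A \<rightarrow>\<^sub>E B)"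
  obtains e where "inj_on e X" "small (e ` X)"
proof -
  obtain Z where Z: "infinite Z" "small Z" "B \<lesssim> Z"
  proof (cases "finite B")
    case True
    then show ?thesis
      using that ex_infinite_small finite_lepoll_infinite by blast
  qed (use B that in auto)
  have "(A \<rightarrow>\<^sub>E B) \<lesssim> (A \<rightarrow>\<^sub>E Z)"
    using Z(3) by (rule lepoll_PiE)
  then have "X \<lesssim> Z"
    using finite_power_lepoll[OF Z(1) A] X by (meson lepoll_trans)
  then obtain e where "inj_on e X" "e ` X \<subseteq> Z"
    unfolding lepoll_def by blast
  then show thesis
    using that small_lepoll[OF Z(2)] subset_imp_lepoll by blast
qed

lemma left_module_transfer:
  assumes M: "left_module R M" and carr: "carrier T = e ` carrier M"
    and zero: "e \<zero>\<^bsub>M\<^esub> = \<zero>\<^bsub>T\<^esub>"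
    and add: "\<And>u v. \<lbrakk>u \<in> carrier M; v \<in> carrier M\<rbrakk> \<Longrightarrow> e u \<oplus>\<^bsub>T\<^esub> e v = e (u \<oplus>\<^bsub>M\<^esub> v)"
    and smult: "\<And>r u. \<lbrakk>r \<in> carrier R; u \<in> carrier M\<rbrakk> \<Longrightarrow> r \<odot>\<^bsub>T\<^esub> e u = e (r \<odot>\<^bsub>M\<^esub> u)"
  shows "left_module R T"
proof -
  interpret left_module R M by fact
  have "abelian_group T"
  proof (rule abelian_groupI)
    show "\<exists>y\<in>carrier T. y \<oplus>\<^bsub>T\<^esub> u = \<zero>\<^bsub>T\<^esub>" if "u \<in> carrier T" for u
    proof -
      from that obtain v where v: "v \<in> carrier M" "u = e v" unfolding carr by blast
      then have "e (\<ominus>\<^bsub>M\<^esub> v) \<oplus>\<^bsub>T\<^esub> u = \<zero>\<^bsub>T\<^esub>"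
        by (simp add: add M.l_neg zero)
      then show ?thesis unfolding carr using v by blast
    qed
  qed (auto simp: carr add M.a_ac simp flip: zero)
  then show ?thesis
    using R.ring_axioms unfolding left_module_def left_module_axioms_def
    by (auto simp: carr add smult smult_closed smult_l_distr smult_r_distr smult_assoc smult_one)
qed

text \<open>Transport of structure along \<open>e\<close>, which is to be injective on the carrier.\<close>
definition encoded_module ::
    "('m \<Rightarrow> 'u) \<Rightarrow> ('a, 'm, 'z) module_scheme \<Rightarrow> ('a, 'u) module" where
  "encoded_module e M = (let d = inv_into (carrier M) e in
     \<lparr>carrier = e ` carrier M, monoid.mult = undefined, one = undefined, ring.zero = e \<zero>\<^bsub>M\<^esub>,
      ring.add = (\<lambda>u v. e (d u \<oplus>\<^bsub>M\<^esub> d v)), smult = (\<lambda>r u. e (r \<odot>\<^bsub>M\<^esub> d u))\<rparr>)"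

lemma encoded_module_lin_maps:
  assumes M: "left_module R M" and e: "inj_on e (carrier M)"
  shows "left_module R (encoded_module e M)"
    and "lin_map R M (encoded_module e M) e"
    and "lin_map R (encoded_module e M) M (inv_into (carrier M) e)"
proof -
  interpret left_module R M by fact
  show 1: "left_module R (encoded_module e M)"
    by (rule left_module_transfer[OF M, where e = e]) (auto simp: encoded_module_def Let_def e)
  show "lin_map R M (encoded_module e M) e"
    by (rule lin_mapI) (auto simp: encoded_module_def Let_def e)
  show "lin_map R (encoded_module e M) M (inv_into (carrier M) e)"
    by (rule lin_mapI) (auto simp: encoded_module_def Let_def e smult_closed)
qed

text \<open>Modules of functions with pointwise addition; the action is a parameter because it is pointwise for powers
  but by translation for coinduced modules.\<close>
definition pointwise_module ::
    "('x \<Rightarrow> 'n) set \<Rightarrow> 'x set \<Rightarrow> ('n, 'z) ring_scheme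
      \<Rightarrow> ('a \<Rightarrow> ('x \<Rightarrow> 'n) \<Rightarrow> 'x \<Rightarrow> 'n) \<Rightarrow> ('a, 'x \<Rightarrow> 'n) module" where
  "pointwise_module F X N act =
     \<lparr>carrier = F, monoid.mult = undefined, one = undefined, ring.zero = (\<lambda>x\<in>X. \<zero>\<^bsub>N\<^esub>),
      ring.add = (\<lambda>f g. \<lambda>x\<in>X. f x \<oplus>\<^bsub>N\<^esub> g x), smult = act\<rparr>"

lemma pointwise_module_abelian_group:
  assumes N: "abelian_group N" and F: "F \<subseteq> X \<rightarrow>\<^sub>E carrier N"
    and zero: "(\<lambda>x\<in>X. \<zero>\<^bsub>N\<^esub>) \<in> F"
    and add: "\<And>f g. \<lbrakk>f \<in> F; g \<in> F\<rbrakk> \<Longrightarrow> (\<lambda>x\<in>X. f x \<oplus>\<^bsub>N\<^esub> g x) \<in> F"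
    and neg: "\<And>f. f \<in> F \<Longrightarrow> (\<lambda>x\<in>X. \<ominus>\<^bsub>N\<^esub> f x) \<in> F"
  shows "abelian_group (pointwise_module F X N act)"
proof -
  interpret N: abelian_group N by fact
  have val: "f x \<in> carrier N" if "f \<in> F" "x \<in> X" for f x
    using that F by auto
  have ext: "f x = undefined" if "f \<in> F" "x \<notin> X" for f x
    using that F PiE_arb[of f X "\<lambda>_. carrier N" x] by blast
  have restrict: "restrict f X = f" if f: "f \<in> F" for f
    using ext[OF f] by (auto simp: fun_eq_iff restrict_def)
  show ?thesis
  proof (rule abelian_groupI)
    show "\<exists>y\<in>carrier (pointwise_module F X N act).
        y \<oplus>\<^bsub>pointwise_module F X N act\<^esub> f = \<zero>\<^bsub>pointwise_module F X N act\<^esub>"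
      if "f \<in> carrier (pointwise_module F X N act)" for f
      using that neg[of f] val[of f]
      by (intro bexI[of _ "\<lambda>x\<in>X. \<ominus>\<^bsub>N\<^esub> f x"])
        (auto simp: pointwise_module_def N.l_neg intro!: restrict_ext)
  qed (auto simp: pointwise_module_def zero add N.a_ac val restrict cong: restrict_cong intro!: restrict_ext)
qed

lemma regular_bimodule_simps [simp]:
  "carrier (regular_bimodule R) = carrier R"
  "\<zero>\<^bsub>regular_bimodule R\<^esub> = \<zero>\<^bsub>R\<^esub>"
  "r \<oplus>\<^bsub>regular_bimodule R\<^esub> r' = r \<oplus>\<^bsub>R\<^esub> r'"
  "r \<odot>\<^bsub>regular_bimodule R\<^esub> r' = r \<otimes>\<^bsub>R\<^esub> r'"
  "rsmult (regular_bimodule R) r r' = r \<otimes>\<^bsub>R\<^esub> r'"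
  by (simp_all add: regular_bimodule_def)

lemma left_module_regular:
  assumes "ring R"
  shows "left_module R (regular_bimodule R)"
proof -
  interpret ring R by fact
  have "abelian_group (regular_bimodule R)"
  proof (rule abelian_groupI)
    show "\<exists>v\<in>carrier (regular_bimodule R). v \<oplus>\<^bsub>regular_bimodule R\<^esub> u = \<zero>\<^bsub>regular_bimodule R\<^esub>"
      if "u \<in> carrier (regular_bimodule R)" for u
      using that l_neg a_inv_closed by auto
  qed (auto simp: a_ac)
  then show ?thesis
    using assms by (auto simp: left_module_def left_module_axioms_def l_distr r_distr m_assoc)
qed

lemma finsum_regular:
  assumes "ring R" "f \<in> A \<rightarrow> carrier R" "finite A"
  shows "finsum (regular_bimodule R) f A = finsum R f A"
proof -
  interpret ring R by fact
  interpret reg: left_module R "regular_bimodule R" using assms(1) by (rule left_module_regular)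
  show ?thesis
    using assms(2,3) additive_finsum[of R "regular_bimodule R" "\<lambda>r. r" f A]
    by (simp add: abelian_group_axioms reg.M.abelian_group_axioms)
qed

context frobenius_system
begin

definition coinduced :: "('a, 'n, 'w) module_scheme \<Rightarrow> ('a, 'a \<Rightarrow> 'n) module" where
  "coinduced N = pointwise_module (mod_hom S_ring (regular_bimodule R) N) (carrier R) N
     (\<lambda>r f. \<lambda>t\<in>carrier R. f (t \<otimes> r))"

context
  fixes N :: "('a, 'n, 'w) module_scheme"
  assumes N: "left_module S_ring N"
begin

interpretation N: left_module S_ring N by (rule N)

lemma coinduced_iff:
  "f \<in> carrier (coinduced N) \<longleftrightarrow> f \<in> carrier R \<rightarrow>\<^sub>E carrier N \<and>
     (\<forall>t\<in>carrier R. \<forall>t'\<in>carrier R. f (t \<oplus> t') = f t \<oplus>\<^bsub>N\<^esub> f t') \<and>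
     (\<forall>s\<in>S. \<forall>t\<in>carrier R. f (s \<otimes> t) = s \<odot>\<^bsub>N\<^esub> f t)"
  by (simp add: coinduced_def pointwise_module_def mod_hom_def)

lemma coinduced_simps:
  "\<zero>\<^bsub>coinduced N\<^esub> = (\<lambda>t\<in>carrier R. \<zero>\<^bsub>N\<^esub>)"
  "f \<oplus>\<^bsub>coinduced N\<^esub> g = (\<lambda>t\<in>carrier R. f t \<oplus>\<^bsub>N\<^esub> g t)"
  "r \<odot>\<^bsub>coinduced N\<^esub> f = (\<lambda>t\<in>carrier R. f (t \<otimes> r))"
  by (simp_all add: coinduced_def pointwise_module_def)

lemma coinduced_val: "\<lbrakk>f \<in> carrier (coinduced N); t \<in> carrier R\<rbrakk> \<Longrightarrow> f t \<in> carrier N"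
  by (auto simp: coinduced_iff)

lemma coinduced_add:
  "\<lbrakk>f \<in> carrier (coinduced N); t \<in> carrier R; t' \<in> carrier R\<rbrakk> \<Longrightarrow> f (t \<oplus> t') = f t \<oplus>\<^bsub>N\<^esub> f t'"
  by (simp add: coinduced_iff)

lemma coinduced_ext: "\<lbrakk>f \<in> carrier (coinduced N); t \<notin> carrier R\<rbrakk> \<Longrightarrow> f t = undefined"
  unfolding coinduced_iff using PiE_arb[of f "carrier R" "\<lambda>_. carrier N" t] by blast

lemma smult_neg: "\<lbrakk>s \<in> S; n \<in> carrier N\<rbrakk> \<Longrightarrow> \<ominus>\<^bsub>N\<^esub> (s \<odot>\<^bsub>N\<^esub> n) = s \<odot>\<^bsub>N\<^esub> (\<ominus>\<^bsub>N\<^esub> n)"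
proof -
  assume s: "s \<in> S" and n: "n \<in> carrier N"
  have "s \<odot>\<^bsub>N\<^esub> (\<ominus>\<^bsub>N\<^esub> n) \<oplus>\<^bsub>N\<^esub> s \<odot>\<^bsub>N\<^esub> n = \<zero>\<^bsub>N\<^esub>"
    using s n N.smult_r_distr[of s "\<ominus>\<^bsub>N\<^esub> n" n] N.smult_zero[of s] by (simp add: N.M.l_neg)
  then show ?thesis
    using s n N.smult_closed by (intro N.M.minus_equality) auto
qed

lemma coinduced_module: "left_module R (coinduced N)"
proof -
  have add: "(\<lambda>t\<in>carrier R. f t \<oplus>\<^bsub>N\<^esub> g t) \<in> carrier (coinduced N)"
    if "f \<in> carrier (coinduced N)" "g \<in> carrier (coinduced N)" for f g
    using that coinduced_val[OF that(1)] coinduced_val[OF that(2)]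
    by (auto simp: coinduced_iff N.smult_r_distr N.M.a_ac)
  have neg: "(\<lambda>t\<in>carrier R. \<ominus>\<^bsub>N\<^esub> f t) \<in> carrier (coinduced N)"
    if "f \<in> carrier (coinduced N)" for f
    using that coinduced_val[OF that] by (auto simp: coinduced_iff N.M.minus_add smult_neg)
  have zero: "(\<lambda>t\<in>carrier R. \<zero>\<^bsub>N\<^esub>) \<in> carrier (coinduced N)"
    using N.smult_zero by (auto simp: coinduced_iff)
  have smult: "(\<lambda>t\<in>carrier R. f (t \<otimes> r)) \<in> carrier (coinduced N)"
    if "f \<in> carrier (coinduced N)" "r \<in> carrier R" for f r
    using that by (auto simp: coinduced_iff l_distr m_assoc)
  have carr: "carrier (coinduced N) = mod_hom S_ring (regular_bimodule R) N"
    by (simp add: coinduced_def pointwise_module_def)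
  have group: "abelian_group (coinduced N)"
    unfolding coinduced_def using add neg zero unfolding carr
    by (intro pointwise_module_abelian_group N.M.abelian_group_axioms) (auto simp: mod_hom_def)
  have one: "\<one> \<odot>\<^bsub>coinduced N\<^esub> f = f" if "f \<in> carrier (coinduced N)" for f
    using coinduced_ext[OF that] by (auto simp: coinduced_simps fun_eq_iff)
  have closed: "r \<odot>\<^bsub>coinduced N\<^esub> f \<in> carrier (coinduced N)"
    if "r \<in> carrier R" "f \<in> carrier (coinduced N)" for r f
    using smult that by (simp add: coinduced_simps)
  have l_dist: "(r \<oplus> r') \<odot>\<^bsub>coinduced N\<^esub> f = r \<odot>\<^bsub>coinduced N\<^esub> f \<oplus>\<^bsub>coinduced N\<^esub> r' \<odot>\<^bsub>coinduced N\<^esub> f"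
    if "r \<in> carrier R" "r' \<in> carrier R" "f \<in> carrier (coinduced N)" for r r' f
    unfolding coinduced_simps using that by (intro restrict_ext) (simp add: r_distr coinduced_add)
  have r_dist: "r \<odot>\<^bsub>coinduced N\<^esub> (f \<oplus>\<^bsub>coinduced N\<^esub> g) = r \<odot>\<^bsub>coinduced N\<^esub> f \<oplus>\<^bsub>coinduced N\<^esub> r \<odot>\<^bsub>coinduced N\<^esub> g"
    if "r \<in> carrier R" for r f g
    unfolding coinduced_simps using that by (intro restrict_ext) simp
  have assoc: "(r \<otimes> r') \<odot>\<^bsub>coinduced N\<^esub> f = r \<odot>\<^bsub>coinduced N\<^esub> (r' \<odot>\<^bsub>coinduced N\<^esub> f)"
    if "r \<in> carrier R" "r' \<in> carrier R" for r r' f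
    unfolding coinduced_simps using that by (intro restrict_ext) (simp add: m_assoc)
  show ?thesis
    by (intro left_module.intro left_module_axioms.intro)
      ((rule R.ring_axioms group closed l_dist r_dist assoc one; assumption?)+)
qed

text \<open>Dual bases make \<open>f\<close> determined by its values on \<open>A\<close>, which bounds the size of the coinduced module.\<close>
lemma coinduced_expansion:
  assumes f: "f \<in> carrier (coinduced N)" and t: "t \<in> carrier R"
  shows "f t = (\<Oplus>\<^bsub>N\<^esub>a\<in>A. E (t \<otimes> x a) \<odot>\<^bsub>N\<^esub> f a)"
proof -
  have "f t = f (\<Oplus>a\<in>A. E (t \<otimes> x a) \<otimes> a)"
    using t by (simp add: left_expansion)
  also have "\<dots> = (\<Oplus>\<^bsub>N\<^esub>a\<in>A. f (E (t \<otimes> x a) \<otimes> a))"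
    using f t finite_A R.abelian_group_axioms N.M.abelian_group_axioms
    by (intro additive_finsum) (auto simp: coinduced_iff)
  also have "\<dots> = (\<Oplus>\<^bsub>N\<^esub>a\<in>A. E (t \<otimes> x a) \<odot>\<^bsub>N\<^esub> f a)"
    using f t by (intro N.M.finsum_cong') (auto simp: coinduced_iff E_closed intro!: N.smult_closed)
  finally show ?thesis .
qed

lemma coinduced_lepoll: "carrier (coinduced N) \<lesssim> (A \<rightarrow>\<^sub>E carrier N)"
proof -
  have "inj_on (\<lambda>f. restrict f A) (carrier (coinduced N))"
  proof (rule inj_onI)
    fix f g assume f: "f \<in> carrier (coinduced N)" and g: "g \<in> carrier (coinduced N)"
      and eq: "restrict f A = restrict g A"
    have "f a = g a" if "a \<in> A" for a
      using fun_cong[OF eq, of a] that by simp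
    then have "f t = g t" if "t \<in> carrier R" for t
      unfolding coinduced_expansion[OF f that] coinduced_expansion[OF g that]
      using that g by (intro N.M.finsum_cong') (auto simp: E_closed coinduced_val intro!: N.smult_closed)
    then show "f = g"
      using coinduced_ext[OF f] coinduced_ext[OF g]
      by (intro extensionalityI[of _ "carrier R"]) (auto simp: extensional_def)
  qed
  moreover have "(\<lambda>f. restrict f A) ` carrier (coinduced N) \<subseteq> (A \<rightarrow>\<^sub>E carrier N)"
    by (auto simp: coinduced_val)
  ultimately show ?thesis unfolding lepoll_def by blast
qed

text \<open>Evaluating the trace of \<open>\<eta> \<epsilon>\<close> at \<open>f\<close> and then at \<open>t\<close> gives the expansion of \<open>f t\<close> in the dual basis.\<close>
lemma coinduced_induced:
  "induced N (coinduced N) (\<lambda>f. f \<one>) (\<lambda>n. \<lambda>t\<in>carrier R. E t \<odot>\<^bsub>N\<^esub> n)"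
proof -
  interpret C: left_module R "coinduced N" by (rule coinduced_module)
  let ?\<eta> = "\<lambda>n. \<lambda>t\<in>carrier R. E t \<odot>\<^bsub>N\<^esub> n"
  have closed: "s \<odot>\<^bsub>N\<^esub> n \<in> carrier N" if "s \<in> S" "n \<in> carrier N" for s n
    using N.smult_closed that by simp
  have l_distr: "(s \<oplus> s') \<odot>\<^bsub>N\<^esub> n = s \<odot>\<^bsub>N\<^esub> n \<oplus>\<^bsub>N\<^esub> s' \<odot>\<^bsub>N\<^esub> n"
    if "s \<in> S" "s' \<in> S" "n \<in> carrier N" for s s' n
    using N.smult_l_distr[of s s' n] that by simp
  have r_distr: "s \<odot>\<^bsub>N\<^esub> (n \<oplus>\<^bsub>N\<^esub> n') = s \<odot>\<^bsub>N\<^esub> n \<oplus>\<^bsub>N\<^esub> s \<odot>\<^bsub>N\<^esub> n'"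
    if "s \<in> S" "n \<in> carrier N" "n' \<in> carrier N" for s n n'
    using N.smult_r_distr[of s n n'] that by simp
  have assoc: "(s \<otimes> s') \<odot>\<^bsub>N\<^esub> n = s \<odot>\<^bsub>N\<^esub> (s' \<odot>\<^bsub>N\<^esub> n)"
    if "s \<in> S" "s' \<in> S" "n \<in> carrier N" for s s' n
    using N.smult_assoc[of s s' n] that by simp
  have \<eta>: "?\<eta> n \<in> carrier (coinduced N)" if "n \<in> carrier N" for n
    using that by (simp add: coinduced_iff E_closed E_add E_left closed l_distr assoc)
  have 1: "lin_map S_ring (coinduced N) N (\<lambda>f. f \<one>)"
  proof (rule lin_mapI)
    fix s f assume s: "s \<in> carrier S_ring" and f: "f \<in> carrier (coinduced N)"
    then have "s \<in> S" by simp
    then have "f (s \<otimes> \<one>) = s \<odot>\<^bsub>N\<^esub> f \<one>"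
      using f R.one_closed unfolding coinduced_iff by blast
    then show "(s \<odot>\<^bsub>coinduced N\<^esub> f) \<one> = s \<odot>\<^bsub>N\<^esub> f \<one>"
      using s by (simp add: coinduced_simps)
  qed (auto simp: coinduced_simps coinduced_val)
  have 2: "lin_map S_ring N (coinduced N) ?\<eta>"
    by (rule lin_mapI)
      (use \<eta> in \<open>auto simp: coinduced_simps E_closed E_right r_distr assoc intro!: restrict_ext\<close>)
  have 3: "(r \<odot>\<^bsub>coinduced N\<^esub> ?\<eta> n) \<one> = E r \<odot>\<^bsub>N\<^esub> n" if "r \<in> carrier R" for r n
    using that by (simp add: coinduced_simps)
  have 4: "trace (coinduced N) (coinduced N) (\<lambda>f. ?\<eta> (f \<one>)) f = f" if f: "f \<in> carrier (coinduced N)" for f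
  proof
    fix t
    show "trace (coinduced N) (coinduced N) (\<lambda>f. ?\<eta> (f \<one>)) f t = f t"
    proof (cases "t \<in> carrier R")
      case True
      have term_closed: "x a \<odot>\<^bsub>coinduced N\<^esub> ?\<eta> ((a \<odot>\<^bsub>coinduced N\<^esub> f) \<one>) \<in> carrier (coinduced N)" if "a \<in> A" for a
        using that f by (intro C.smult_closed \<eta> coinduced_val[OF C.smult_closed]) auto
      have "trace (coinduced N) (coinduced N) (\<lambda>f. ?\<eta> (f \<one>)) f t =
          (\<Oplus>\<^bsub>N\<^esub>a\<in>A. (x a \<odot>\<^bsub>coinduced N\<^esub> ?\<eta> ((a \<odot>\<^bsub>coinduced N\<^esub> f) \<one>)) t)"
        unfolding trace_def using term_closed True finite_A
        by (intro additive_finsum[where f = "\<lambda>f. f t"] C.M.abelian_group_axioms N.M.abelian_group_axioms)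
          (auto simp: coinduced_val coinduced_simps(2))
      also have "\<dots> = (\<Oplus>\<^bsub>N\<^esub>a\<in>A. E (t \<otimes> x a) \<odot>\<^bsub>N\<^esub> f a)"
        using f True by (intro N.M.finsum_cong')
          (auto simp: coinduced_simps coinduced_val E_closed closed)
      finally show ?thesis using coinduced_expansion[OF f True] by simp
    next
      case False
      have "trace (coinduced N) (coinduced N) (\<lambda>f. ?\<eta> (f \<one>)) f \<in> carrier (coinduced N)"
        using f by (intro trace_closed C.left_module_axioms \<eta>) (auto simp: coinduced_val)
      then show ?thesis using False f coinduced_ext by metis
    qed
  qed
  show ?thesis
    unfolding induced_def using N C.left_module_axioms 1 2 3 4 by blast
qed

end

lemma induced_encoded:
  assumes ind: "induced N C \<epsilon> \<eta>" and e: "inj_on e (carrier C)"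
  shows "induced N (encoded_module e C) (\<lambda>u. \<epsilon> (inv_into (carrier C) e u)) (\<lambda>n. e (\<eta> n))"
proof -
  let ?D = "encoded_module e C" and ?d = "inv_into (carrier C) e"
  note C = induced_modules(2)[OF ind]
  note D = encoded_module_lin_maps[OF C e]
  interpret C: left_module R C by (rule C)
  have de: "?d (e u) = u" if "u \<in> carrier C" for u using e that by simp
  have "lin_map S_ring ?D N (\<lambda>u. \<epsilon> (?d u))"
    using restrict_lin_map[OF D(3)] induced_lin_maps(1)[OF ind] by (rule lin_map_compose)
  moreover have "lin_map S_ring N ?D (\<lambda>n. e (\<eta> n))"
    using induced_lin_maps(2)[OF ind] restrict_lin_map[OF D(2)] by (rule lin_map_compose)
  moreover have "\<epsilon> (?d (r \<odot>\<^bsub>?D\<^esub> e (\<eta> n))) = E r \<odot>\<^bsub>N\<^esub> n" if "r \<in> carrier R" "n \<in> carrier N" for r n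
    using that induced_closed(2)[OF ind]
    by (simp add: lin_map_smult[OF D(2), symmetric] de C.smult_closed induced_unit[OF ind])
  moreover have "trace ?D ?D (\<lambda>v. e (\<eta> (\<epsilon> (?d v)))) w = w" if w: "w \<in> carrier ?D" for w
  proof -
    have dw: "?d w \<in> carrier C" "e (?d w) = w"
      using w lin_map_closed[OF D(3)] by (auto simp: encoded_module_def Let_def f_inv_into_f)
    have "trace ?D ?D (\<lambda>v. e (\<eta> (\<epsilon> (?d v)))) w = e (trace ?D C (\<lambda>v. \<eta> (\<epsilon> (?d v))) w)"
      using w lin_map_closed[OF D(3)] induced_closed[OF ind]
      by (intro trace_post_compose[symmetric] D C) auto
    also have "trace ?D C (\<lambda>v. \<eta> (\<epsilon> (?d v))) w = trace C C (\<lambda>v. \<eta> (\<epsilon> v)) (?d w)"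
      using w induced_closed[OF ind] by (intro trace_pre_compose[symmetric] D C) auto
    finally show ?thesis
      using dw by (simp add: induced_trace[OF ind])
  qed
  ultimately show ?thesis
    unfolding induced_def using D(1) induced_modules(1)[OF ind] by blast
qed

text \<open>The module \<open>Hom\<^sub>S(R, N)\<close> consists of functions; its small copy is an object of the category.\<close>
lemma exists_small_induced:
  fixes N :: "('a, 'u) module"
  assumes "small_sets small" and N: "N \<in> left_modules small S_ring"
  shows "\<exists>(C :: ('a, 'u) module) \<epsilon> \<eta>. induced N C \<epsilon> \<eta> \<and> small (carrier C)"
proof -
  interpret small_sets small by fact
  have modN: "left_module S_ring N" and smallN: "small (carrier N)"
    using N by (auto simp: left_modules_def)
  obtain e where e: "inj_on e (carrier (coinduced N))" "small (e ` carrier (coinduced N))"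
    using small_encoding[OF smallN finite_A coinduced_lepoll[OF modN]] .
  have "carrier (encoded_module e (coinduced N)) = e ` carrier (coinduced N)"
    by (simp add: encoded_module_def Let_def)
  then have "small (carrier (encoded_module e (coinduced N)))"
    using e(2) by simp
  then show ?thesis
    using induced_encoded[OF coinduced_induced[OF modN] e(1)] by blast
qed

end

section \<open>The Frobenius system of a Frobenius extension\<close>

definition power_module :: "'x set \<Rightarrow> ('a, 'k) ring_scheme \<Rightarrow> ('a, 'x \<Rightarrow> 'a) module" where
  "power_module A R = pointwise_module (A \<rightarrow>\<^sub>E carrier R) A R (\<lambda>r f. \<lambda>a\<in>A. r \<otimes>\<^bsub>R\<^esub> f a)"

lemma power_module_simps [simp]:
  "carrier (power_module A R) = A \<rightarrow>\<^sub>E carrier R"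
  "f \<oplus>\<^bsub>power_module A R\<^esub> g = (\<lambda>a\<in>A. f a \<oplus>\<^bsub>R\<^esub> g a)"
  "r \<odot>\<^bsub>power_module A R\<^esub> f = (\<lambda>a\<in>A. r \<otimes>\<^bsub>R\<^esub> f a)"
  by (simp_all add: power_module_def pointwise_module_def)

lemma left_module_power:
  assumes "ring R"
  shows "left_module R (power_module A R)"
proof -
  interpret ring R by fact
  have "abelian_group (power_module A R)"
    unfolding power_module_def
    by (rule pointwise_module_abelian_group) (auto intro: abelian_group_axioms)
  moreover have "left_module_axioms R (power_module A R)"
  proof
    fix f assume f: "f \<in> carrier (power_module A R)"
    then have fa: "f a \<in> carrier R" if "a \<in> A" for a using that by auto
    show "\<one>\<^bsub>R\<^esub> \<odot>\<^bsub>power_module A R\<^esub> f = f"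
      by (rule extensionalityI[of _ A]) (use f fa in \<open>auto simp: PiE_def\<close>)
    show "r \<odot>\<^bsub>power_module A R\<^esub> f \<in> carrier (power_module A R)" if "r \<in> carrier R" for r
      using that fa by auto
    fix r r' assume r: "r \<in> carrier R" "r' \<in> carrier R"
    show "(r \<oplus>\<^bsub>R\<^esub> r') \<odot>\<^bsub>power_module A R\<^esub> f
        = r \<odot>\<^bsub>power_module A R\<^esub> f \<oplus>\<^bsub>power_module A R\<^esub> r' \<odot>\<^bsub>power_module A R\<^esub> f"
      using r fa by (auto simp: l_distr intro!: restrict_ext)
    show "(r \<otimes>\<^bsub>R\<^esub> r') \<odot>\<^bsub>power_module A R\<^esub> f = r \<odot>\<^bsub>power_module A R\<^esub> (r' \<odot>\<^bsub>power_module A R\<^esub> f)"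
      using r fa by (auto simp: m_assoc intro!: restrict_ext)
  next
    fix r f g assume r: "r \<in> carrier R"
      and f: "f \<in> carrier (power_module A R)" and g: "g \<in> carrier (power_module A R)"
    have "f a \<in> carrier R" "g a \<in> carrier R" if "a \<in> A" for a using that f g by auto
    then show "r \<odot>\<^bsub>power_module A R\<^esub> (f \<oplus>\<^bsub>power_module A R\<^esub> g)
        = r \<odot>\<^bsub>power_module A R\<^esub> f \<oplus>\<^bsub>power_module A R\<^esub> r \<odot>\<^bsub>power_module A R\<^esub> g"
      using r by (auto simp: r_distr intro!: restrict_ext)
  qed
  ultimately show ?thesis
    using assms by (simp add: left_module_def)
qed

text \<open>Dual basis lemma: the surjection from the free module on a finite generating set splits, and the coordinates of
  the splitting are the \<open>c a\<close>. The free module has to be replaced by a copy inside \<open>'u\<close>, since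
  projectivity only speaks of modules there.\<close>
lemma projective_dual_basis:
  fixes T :: "'u ring" and M :: "('u, 'u, 'z) module_scheme"
  assumes "small_sets small" and ring: "ring T" and small_T: "small (carrier T)"
    and small_M: "small (carrier M)"
    and fg: "finitely_generated T M" and proj: "projective small T M"
  obtains A c where "finite A" "A \<subseteq> carrier M"
    and "\<And>a. a \<in> A \<Longrightarrow> lin_map T M (regular_bimodule T) (c a)"
    and "\<And>u. u \<in> carrier M \<Longrightarrow> (\<Oplus>\<^bsub>M\<^esub>a\<in>A. c a u \<odot>\<^bsub>M\<^esub> a) = u"
proof -
  interpret small_sets small by fact
  interpret T: ring T by fact
  have M: "left_module T M" using proj by (simp add: projective_def)
  interpret M: left_module T M by (rule M)
  from fg obtain A where A: "finite A" "A \<subseteq> carrier M"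
    and gen: "carrier M = {\<Oplus>\<^bsub>M\<^esub>a\<in>A. c a \<odot>\<^bsub>M\<^esub> a | c. c \<in> A \<rightarrow> carrier T}"
    unfolding finitely_generated_def by blast
  let ?F = "power_module A T"
  have F: "left_module T ?F" using ring by (rule left_module_power)
  obtain e where e: "inj_on e (carrier ?F)" "small (e ` carrier ?F)"
    using small_encoding[OF small_T A(1), of "carrier ?F"] by auto
  let ?G = "encoded_module e ?F"
  let ?d = "inv_into (carrier ?F) e"
  note G = encoded_module_lin_maps[OF F e(1)]
  let ?M = "module.truncate M"
  have truncate: "carrier ?M = carrier M" "\<zero>\<^bsub>?M\<^esub> = \<zero>\<^bsub>M\<^esub>" "\<And>u v. u \<oplus>\<^bsub>?M\<^esub> v = u \<oplus>\<^bsub>M\<^esub> v" "\<And>r u. r \<odot>\<^bsub>?M\<^esub> u = r \<odot>\<^bsub>M\<^esub> u"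
    by (simp_all add: module.truncate_def)
  have modM: "left_module T ?M"
    by (rule left_module_transfer[OF M, where e = "\<lambda>u. u"]) (simp_all add: truncate)
  define q where "q f = (\<Oplus>\<^bsub>M\<^esub>a\<in>A. f a \<odot>\<^bsub>M\<^esub> a)" for f
  have term_closed: "f a \<odot>\<^bsub>M\<^esub> a \<in> carrier M" if "f \<in> A \<rightarrow> carrier T" "a \<in> A" for f a
    using that A by (intro M.smult_closed) auto
  have q: "lin_map T ?F ?M q"
  proof (rule lin_mapI, unfold truncate)
    fix f assume "f \<in> carrier ?F"
    then show "q f \<in> carrier M"
      unfolding q_def by (intro M.M.finsum_closed) (auto intro!: term_closed)
  next
    fix f g assume f: "f \<in> carrier ?F" and g: "g \<in> carrier ?F"
    have fg: "f a \<in> carrier T" "g a \<in> carrier T" "a \<in> carrier M" if "a \<in> A" for a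
      using f g A that by auto
    have "q (f \<oplus>\<^bsub>?F\<^esub> g) = (\<Oplus>\<^bsub>M\<^esub>a\<in>A. f a \<odot>\<^bsub>M\<^esub> a \<oplus>\<^bsub>M\<^esub> g a \<odot>\<^bsub>M\<^esub> a)"
      unfolding q_def by (intro M.M.finsum_cong') (auto simp: M.smult_l_distr fg M.smult_closed)
    also have "\<dots> = q f \<oplus>\<^bsub>M\<^esub> q g"
      unfolding q_def using f g by (intro M.M.finsum_addf) (auto intro!: term_closed)
    finally show "q (f \<oplus>\<^bsub>?F\<^esub> g) = q f \<oplus>\<^bsub>M\<^esub> q g" .
  next
    fix r f assume r: "r \<in> carrier T" and f: "f \<in> carrier ?F"
    have fa: "f a \<in> carrier T" "a \<in> carrier M" if "a \<in> A" for a
      using f A that by auto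
    have "q (r \<odot>\<^bsub>?F\<^esub> f) = (\<Oplus>\<^bsub>M\<^esub>a\<in>A. r \<odot>\<^bsub>M\<^esub> (f a \<odot>\<^bsub>M\<^esub> a))"
      unfolding q_def using r by (intro M.M.finsum_cong') (auto simp: M.smult_assoc fa M.smult_closed)
    also have "\<dots> = r \<odot>\<^bsub>M\<^esub> q f"
      unfolding q_def using r f A by (intro M.smult_finsum[symmetric]) (auto intro!: term_closed)
    finally show "q (r \<odot>\<^bsub>?F\<^esub> f) = r \<odot>\<^bsub>M\<^esub> q f" .
  qed
  have p: "lin_map T ?G ?M (\<lambda>w. q (?d w))"
    using G(3) q by (rule lin_map_compose)
  have surj: "(\<lambda>w. q (?d w)) ` carrier ?G = carrier ?M"
  proof (intro subset_antisym subsetI)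
    fix u assume "u \<in> carrier ?M"
    then obtain f where f: "f \<in> A \<rightarrow> carrier T" "u = (\<Oplus>\<^bsub>M\<^esub>a\<in>A. f a \<odot>\<^bsub>M\<^esub> a)"
      unfolding truncate gen by blast
    have fA: "restrict f A \<in> carrier ?F" using f by auto
    have "q (?d (e (restrict f A))) = u"
      unfolding inv_into_f_f[OF e(1) fA] f(2) q_def
      by (intro M.M.finsum_cong') (use f term_closed in auto)
    moreover have "e (restrict f A) \<in> carrier ?G"
      using lin_map_closed[OF G(2) fA] .
    ultimately show "u \<in> (\<lambda>w. q (?d w)) ` carrier ?G" by blast
  qed (use lin_map_closed[OF p] in auto)
  have "carrier ?G = e ` carrier ?F" by (simp add: encoded_module_def Let_def)
  then have GM: "?G \<in> left_modules small T" "?M \<in> left_modules small T"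
    using G(1) modM e(2) small_M by (auto simp: left_modules_def truncate)
  have id: "lin_map T M ?M (\<lambda>u. u)"
    by (rule lin_mapI) (simp_all add: truncate)
  have lift: "\<exists>g. lin_map T M ?G g \<and> (\<forall>u\<in>carrier M. p (g u) = f u)"
    if "lin_map T ?G ?M p" "p ` carrier ?G = carrier ?M" "lin_map T M ?M f" for p f
    using proj GM that unfolding projective_iff by blast
  obtain g where g: "lin_map T M ?G g" "\<And>u. u \<in> carrier M \<Longrightarrow> q (?d (g u)) = u"
    using lift[OF p surj id] by blast
  have dg: "lin_map T M ?F (\<lambda>u. ?d (g u))"
    using g(1) G(3) by (rule lin_map_compose)
  show thesis
  proof (rule that[of A "\<lambda>a u. ?d (g u) a"])
    fix a assume a: "a \<in> A"
    show "lin_map T M (regular_bimodule T) (\<lambda>u. ?d (g u) a)"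
    proof (rule lin_mapI)
      show "?d (g u) a \<in> carrier (regular_bimodule T)" if "u \<in> carrier M" for u
        using lin_map_closed[OF dg that] a by auto
    next
      fix u v assume "u \<in> carrier M" "v \<in> carrier M"
      from fun_cong[OF lin_map_add[OF dg this], of a]
      show "?d (g (u \<oplus>\<^bsub>M\<^esub> v)) a = ?d (g u) a \<oplus>\<^bsub>regular_bimodule T\<^esub> ?d (g v) a"
        using a by simp
    next
      fix r u assume "r \<in> carrier T" "u \<in> carrier M"
      from fun_cong[OF lin_map_smult[OF dg this], of a]
      show "?d (g (r \<odot>\<^bsub>M\<^esub> u)) a = r \<odot>\<^bsub>regular_bimodule T\<^esub> ?d (g u) a"
        using a by simp
    qed
  qed (use A g(2) in \<open>auto simp: q_def\<close>)
qed

text \<open>Let \<open>E\<close> be the image of 1 under the isomorphism \<open>\<Phi>\<close>. Linearity of \<open>\<Phi>\<close> over \<open>R\<close> gives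
  \<open>\<Phi> r = E(\<cdot> r)\<close>, so the coordinate functions of a dual basis have the form \<open>E(\<cdot> x\<^sub>a)\<close>, which is the left
  expansion. Both sides of the right expansion have the same image under \<open>\<Phi>\<close> by the left one.\<close>
lemma frobenius_extension_imp_system:
  fixes R :: "'u ring"
  assumes small: "small_sets small" and small_R: "small (carrier R)"
    and frob: "frobenius_extension small S R"
  shows "\<exists>A x E. frobenius_system S R A x E"
proof -
  interpret small_sets small by fact
  let ?S = "R\<lparr>carrier := S\<rparr>"
  let ?H = "Hom_bimodule ?S (regular_bimodule R) (regular_bimodule ?S)"
  have sub: "subring S R" and ring: "ring R" using frob by (auto simp: frobenius_extension_def)
  interpret R: ring R by fact
  interpret S: subring S R by fact
  have ring_S: "ring ?S" using sub by (rule R.subring_is_ring)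
  have SR: "s \<in> carrier R" if "s \<in> S" for s using that S.subset by blast
  have small_S: "small S" using small_lepoll[OF small_R] subset_imp_lepoll[OF S.subset] by blast
  obtain A c where A: "finite A" "A \<subseteq> carrier R"
    and c: "\<And>a. a \<in> A \<Longrightarrow> lin_map ?S (regular_bimodule R) (regular_bimodule ?S) (c a)"
    and dual: "\<And>r. r \<in> carrier R \<Longrightarrow> (\<Oplus>\<^bsub>regular_bimodule R\<^esub>a\<in>A. c a r \<odot>\<^bsub>regular_bimodule R\<^esub> a) = r"
    using projective_dual_basis[of small ?S "regular_bimodule R"] small ring_S small_S small_R frob
    unfolding frobenius_extension_def by auto
  from frob obtain \<Phi> where \<Phi>: "\<Phi> \<in> bimod_hom R ?S (regular_bimodule R) ?H"
    "bij_betw \<Phi> (carrier R) (mod_hom ?S (regular_bimodule R) (regular_bimodule ?S))"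
    unfolding frobenius_extension_def bimod_iso_def by (auto simp: Hom_bimodule_def)
  define E where "E = \<Phi> \<one>\<^bsub>R\<^esub>"
  have \<Phi>_hom: "\<Phi> r \<in> mod_hom ?S (regular_bimodule R) (regular_bimodule ?S)" if "r \<in> carrier R" for r
    using bij_betwE[OF \<Phi>(2)] that by blast
  have E: "lin_map ?S (regular_bimodule R) (regular_bimodule ?S) E"
    using \<Phi>_hom[of "\<one>\<^bsub>R\<^esub>"] by (simp add: E_def mod_hom_iff)
  have E_closed: "E r \<in> S" if "r \<in> carrier R" for r
    using lin_map_closed[OF E] that by simp
  have E_add: "E (r \<oplus>\<^bsub>R\<^esub> r') = E r \<oplus>\<^bsub>R\<^esub> E r'" if "r \<in> carrier R" "r' \<in> carrier R" for r r'
    using lin_map_add[OF E, of r r'] that by simp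
  have E_left: "E (s \<otimes>\<^bsub>R\<^esub> r) = s \<otimes>\<^bsub>R\<^esub> E r" if "s \<in> S" "r \<in> carrier R" for s r
    using lin_map_smult[OF E, of s r] that by simp
  have \<Phi>_left: "\<Phi> r t = E (t \<otimes>\<^bsub>R\<^esub> r)" if "r \<in> carrier R" "t \<in> carrier R" for r t
  proof -
    have "\<Phi> (r \<otimes>\<^bsub>R\<^esub> \<one>\<^bsub>R\<^esub>) = r \<odot>\<^bsub>?H\<^esub> E"
      using \<Phi>(1) that(1) lin_map_smult[of R "regular_bimodule R" ?H \<Phi> r "\<one>\<^bsub>R\<^esub>"]
      by (simp add: bimod_hom_def mod_hom_iff E_def)
    then show ?thesis using that by (simp add: Hom_bimodule_def)
  qed
  have E_right: "E (t \<otimes>\<^bsub>R\<^esub> s) = E t \<otimes>\<^bsub>R\<^esub> s" if "s \<in> S" "t \<in> carrier R" for s t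
  proof -
    have "\<forall>r\<in>carrier R. \<forall>s\<in>S. \<Phi> (r \<otimes>\<^bsub>R\<^esub> s) = rsmult ?H (\<Phi> r) s"
      using \<Phi>(1) by (simp add: bimod_hom_def)
    then have "\<Phi> (\<one>\<^bsub>R\<^esub> \<otimes>\<^bsub>R\<^esub> s) = rsmult ?H E s"
      unfolding E_def using that(1) R.one_closed by blast
    then have "\<Phi> s t = E t \<otimes>\<^bsub>R\<^esub> s" using that SR by (simp add: Hom_bimodule_def)
    then show ?thesis using \<Phi>_left[of s t] that SR by simp
  qed
  have "\<exists>y\<in>carrier R. \<forall>t\<in>carrier R. E (t \<otimes>\<^bsub>R\<^esub> y) = c a t" if a: "a \<in> A" for a
  proof -
    have "left_module ?S (regular_bimodule R)"
      using left_module.restrict_scalars[OF left_module_regular[OF ring] sub] .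
    then have "restrict (c a) (carrier R) \<in> mod_hom ?S (regular_bimodule R) (regular_bimodule ?S)"
      using restrict_mod_hom[OF _ c[OF a]] by simp
    then obtain y where y: "y \<in> carrier R" "\<Phi> y = restrict (c a) (carrier R)"
      using \<Phi>(2) unfolding bij_betw_def by (metis imageE)
    then have "\<forall>t\<in>carrier R. E (t \<otimes>\<^bsub>R\<^esub> y) = c a t"
      using \<Phi>_left[OF y(1)] by simp
    then show ?thesis using y(1) by blast
  qed
  then obtain x where x: "\<And>a. a \<in> A \<Longrightarrow> x a \<in> carrier R"
    "\<And>a t. \<lbrakk>a \<in> A; t \<in> carrier R\<rbrakk> \<Longrightarrow> E (t \<otimes>\<^bsub>R\<^esub> x a) = c a t" by metis
  have a: "a \<in> carrier R" if "a \<in> A" for a using A that by blast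
  have E_carrier: "E r \<in> carrier R" if "r \<in> carrier R" for r using E_closed[OF that] SR by blast
  have left: "(\<Oplus>\<^bsub>R\<^esub>a\<in>A. E (r \<otimes>\<^bsub>R\<^esub> x a) \<otimes>\<^bsub>R\<^esub> a) = r" if r: "r \<in> carrier R" for r
  proof -
    have "(\<Oplus>\<^bsub>R\<^esub>a\<in>A. E (r \<otimes>\<^bsub>R\<^esub> x a) \<otimes>\<^bsub>R\<^esub> a) = (\<Oplus>\<^bsub>R\<^esub>a\<in>A. c a r \<otimes>\<^bsub>R\<^esub> a)"
      using r x a E_carrier by (intro R.finsum_cong') (auto simp flip: x(2))
    also have "\<dots> = (\<Oplus>\<^bsub>regular_bimodule R\<^esub>a\<in>A. c a r \<odot>\<^bsub>regular_bimodule R\<^esub> a)"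
      using r x a E_carrier A(1) by (subst finsum_regular[OF ring]) (auto simp flip: x(2))
    finally show ?thesis using dual[OF r] by simp
  qed
  have right: "(\<Oplus>\<^bsub>R\<^esub>a\<in>A. x a \<otimes>\<^bsub>R\<^esub> E (a \<otimes>\<^bsub>R\<^esub> r)) = r" if r: "r \<in> carrier R" for r
  proof -
    let ?r = "\<Oplus>\<^bsub>R\<^esub>a\<in>A. x a \<otimes>\<^bsub>R\<^esub> E (a \<otimes>\<^bsub>R\<^esub> r)"
    have r': "?r \<in> carrier R" using r x a E_carrier by (intro R.finsum_closed) auto
    have "E (t \<otimes>\<^bsub>R\<^esub> ?r) = E (t \<otimes>\<^bsub>R\<^esub> r)" if t: "t \<in> carrier R" for t
    proof -
      have "E (t \<otimes>\<^bsub>R\<^esub> ?r) = E (\<Oplus>\<^bsub>R\<^esub>a\<in>A. t \<otimes>\<^bsub>R\<^esub> (x a \<otimes>\<^bsub>R\<^esub> E (a \<otimes>\<^bsub>R\<^esub> r)))"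
        using r t x a E_carrier A(1) by (subst R.finsum_rdistr) auto
      also have "\<dots> = (\<Oplus>\<^bsub>R\<^esub>a\<in>A. E (t \<otimes>\<^bsub>R\<^esub> (x a \<otimes>\<^bsub>R\<^esub> E (a \<otimes>\<^bsub>R\<^esub> r))))"
        using r t x a E_carrier A(1) E_add R.abelian_group_axioms
        by (intro additive_finsum) auto
      also have "\<dots> = (\<Oplus>\<^bsub>R\<^esub>a\<in>A. E (E (t \<otimes>\<^bsub>R\<^esub> x a) \<otimes>\<^bsub>R\<^esub> a \<otimes>\<^bsub>R\<^esub> r))"
      proof (intro R.finsum_cong')
        fix b assume b: "b \<in> A"
        have "E (t \<otimes>\<^bsub>R\<^esub> (x b \<otimes>\<^bsub>R\<^esub> E (b \<otimes>\<^bsub>R\<^esub> r))) = E ((t \<otimes>\<^bsub>R\<^esub> x b) \<otimes>\<^bsub>R\<^esub> E (b \<otimes>\<^bsub>R\<^esub> r))"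
          using b r t x a E_carrier by (simp add: R.m_assoc)
        also have "\<dots> = E (t \<otimes>\<^bsub>R\<^esub> x b) \<otimes>\<^bsub>R\<^esub> E (b \<otimes>\<^bsub>R\<^esub> r)"
          using b r t x(1) a by (intro E_right E_closed) auto
        also have "\<dots> = E (E (t \<otimes>\<^bsub>R\<^esub> x b) \<otimes>\<^bsub>R\<^esub> (b \<otimes>\<^bsub>R\<^esub> r))"
          using b r t x(1) a by (intro E_left[symmetric] E_closed) auto
        finally show "E (t \<otimes>\<^bsub>R\<^esub> (x b \<otimes>\<^bsub>R\<^esub> E (b \<otimes>\<^bsub>R\<^esub> r))) = E (E (t \<otimes>\<^bsub>R\<^esub> x b) \<otimes>\<^bsub>R\<^esub> b \<otimes>\<^bsub>R\<^esub> r)"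
          using b r t x(1) a E_carrier by (simp add: R.m_assoc)
      qed (use r t x(1) a E_carrier in auto)
      also have "\<dots> = E (\<Oplus>\<^bsub>R\<^esub>a\<in>A. E (t \<otimes>\<^bsub>R\<^esub> x a) \<otimes>\<^bsub>R\<^esub> a \<otimes>\<^bsub>R\<^esub> r)"
        using r t x(1) a E_carrier A(1) E_add R.abelian_group_axioms
        by (intro additive_finsum[symmetric]) auto
      also have "\<dots> = E ((\<Oplus>\<^bsub>R\<^esub>a\<in>A. E (t \<otimes>\<^bsub>R\<^esub> x a) \<otimes>\<^bsub>R\<^esub> a) \<otimes>\<^bsub>R\<^esub> r)"
        using r t x(1) a E_carrier A(1) by (subst R.finsum_ldistr) auto
      finally show ?thesis using left[OF t] by simp
    qed
    then have "\<Phi> ?r t = \<Phi> r t" if "t \<in> carrier R" for t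
      using \<Phi>_left[OF r' that] \<Phi>_left[OF r that] that by simp
    then have "\<Phi> ?r = \<Phi> r"
      using \<Phi>_hom[OF r'] \<Phi>_hom[OF r] by (intro extensionalityI[of _ "carrier R"]) (auto simp: mod_hom_iff)
    then show ?thesis
      using \<Phi>(2) r r' unfolding bij_betw_def by (meson inj_onD)
  qed
  have "frobenius_system S R A x E"
    using ring sub A x(1) E_closed E_add E_left E_right left right
    by (auto simp: frobenius_system_def frobenius_system_axioms_def)
  then show ?thesis by blast
qed

section \<open>Separability elements\<close>

text \<open>The extension of \<open>B\<close> to a homomorphism on the free abelian group, in the form in which the multiplication map
  \<open>R \<otimes>\<^sub>S R \<rightarrow> R\<close> is written.\<close>
definition (in ring) frag_sum :: "('p \<Rightarrow> 'a) \<Rightarrow> ('p \<Rightarrow>\<^sub>0 int) \<Rightarrow> 'a" where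
  "frag_sum B z = (\<Oplus>p\<in>Poly_Mapping.keys z. add_pow R (Poly_Mapping.lookup z p) (B p))"

context ring
begin

lemma frag_sum_superset:
  assumes B: "B \<in> X \<rightarrow> carrier R" and Y: "Poly_Mapping.keys z \<subseteq> Y" "Y \<subseteq> X" "finite Y"
  shows "frag_sum B z = (\<Oplus>p\<in>Y. add_pow R (Poly_Mapping.lookup z p) (B p))"
  unfolding frag_sum_def
proof (rule add.finprod_mono_neutral_cong_left)
  show "add_pow R (Poly_Mapping.lookup z p) (B p) = \<zero>" if "p \<in> Y - Poly_Mapping.keys z" for p
    using that by (auto simp: in_keys_iff add_pow_def)
qed (use assms in \<open>auto simp: Pi_iff subset_iff\<close>)

lemma frag_sum_closed:
  assumes "B \<in> X \<rightarrow> carrier R" "Poly_Mapping.keys z \<subseteq> X"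
  shows "frag_sum B z \<in> carrier R"
  unfolding frag_sum_def using assms by (intro finsum_closed) auto

lemma frag_sum_add:
  assumes B: "B \<in> X \<rightarrow> carrier R" and z: "Poly_Mapping.keys z \<subseteq> X" and w: "Poly_Mapping.keys w \<subseteq> X"
  shows "frag_sum B (z + w) = frag_sum B z \<oplus> frag_sum B w"
proof -
  let ?Y = "Poly_Mapping.keys z \<union> Poly_Mapping.keys w"
  have Y: "?Y \<subseteq> X" "finite ?Y" using z w by auto
  have BY: "B p \<in> carrier R" if "p \<in> ?Y" for p using B Y that by auto
  have "frag_sum B (z + w) = (\<Oplus>p\<in>?Y. add_pow R (Poly_Mapping.lookup (z + w) p) (B p))"
    using B keys_add[of z w] Y by (rule frag_sum_superset)
  also have "\<dots> = (\<Oplus>p\<in>?Y. add_pow R (Poly_Mapping.lookup z p) (B p) \<oplus> add_pow R (Poly_Mapping.lookup w p) (B p))"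
    using BY by (intro finsum_cong') (auto simp: lookup_add add.int_pow_mult)
  also have "\<dots> = frag_sum B z \<oplus> frag_sum B w"
    using BY unfolding frag_sum_superset[OF B Un_upper1 Y] frag_sum_superset[OF B Un_upper2 Y]
    by (intro finsum_addf) auto
  finally show ?thesis .
qed

lemma frag_sum_of: "B p \<in> carrier R \<Longrightarrow> frag_sum B (frag_of p) = B p"
  by (simp add: frag_sum_def)

lemma frag_additive_diff:
  fixes f :: "('p \<Rightarrow>\<^sub>0 int) \<Rightarrow> 'a"
  assumes closed: "\<And>z. Poly_Mapping.keys z \<subseteq> X \<Longrightarrow> f z \<in> carrier R"
    and add: "\<And>z w. \<lbrakk>Poly_Mapping.keys z \<subseteq> X; Poly_Mapping.keys w \<subseteq> X\<rbrakk> \<Longrightarrow> f (z + w) = f z \<oplus> f w"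
    and z: "Poly_Mapping.keys z \<subseteq> X" and w: "Poly_Mapping.keys w \<subseteq> X"
  shows "f (z - w) = f z \<ominus> f w"
proof -
  have zw: "Poly_Mapping.keys (z - w) \<subseteq> X" using z w keys_diff[of z w] by blast
  have "f z = f (z - w) \<oplus> f w" using add[OF zw w] by simp
  then show ?thesis
    using closed[OF zw] closed[OF w] by (simp add: minus_eq a_assoc r_neg)
qed

text \<open>Uniqueness in the universal property of the free abelian group. It reduces the identities
  below to generators.\<close>
lemma frag_additive_eqI:
  fixes f g :: "('p \<Rightarrow>\<^sub>0 int) \<Rightarrow> 'a"
  assumes f: "\<And>z. Poly_Mapping.keys z \<subseteq> X \<Longrightarrow> f z \<in> carrier R"
      "\<And>z w. \<lbrakk>Poly_Mapping.keys z \<subseteq> X; Poly_Mapping.keys w \<subseteq> X\<rbrakk> \<Longrightarrow> f (z + w) = f z \<oplus> f w"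
    and g: "\<And>z. Poly_Mapping.keys z \<subseteq> X \<Longrightarrow> g z \<in> carrier R"
      "\<And>z w. \<lbrakk>Poly_Mapping.keys z \<subseteq> X; Poly_Mapping.keys w \<subseteq> X\<rbrakk> \<Longrightarrow> g (z + w) = g z \<oplus> g w"
    and eq: "\<And>p. p \<in> X \<Longrightarrow> f (frag_of p) = g (frag_of p)"
    and z: "Poly_Mapping.keys z \<subseteq> X"
  shows "f z = g z"
proof (rule free_Abelian_group_induct[OF z])
  have "f 0 = \<zero>" "g 0 = \<zero>"
    using f(1)[of 0] f(2)[of 0 0] g(1)[of 0] g(2)[of 0 0] add.l_cancel_one by force+
  then show "f 0 = g 0" by simp
next
  fix z w :: "'p \<Rightarrow>\<^sub>0 int"
  assume zw: "Poly_Mapping.keys z \<subseteq> X" "Poly_Mapping.keys w \<subseteq> X" and IH: "f z = g z" "f w = g w"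
  have "f (z - w) = f z \<ominus> f w" using f zw by (rule frag_additive_diff)
  moreover have "g (z - w) = g z \<ominus> g w" using g zw by (rule frag_additive_diff)
  ultimately show "f (z - w) = g (z - w)" using IH by simp
qed (rule eq)

lemma frag_sum_frag_extend:
  assumes B: "B \<in> X \<rightarrow> carrier R" and h: "h \<in> X \<rightarrow> X" and z: "Poly_Mapping.keys z \<subseteq> X"
  shows "frag_sum B (frag_extend (\<lambda>p. frag_of (h p)) z) = frag_sum (\<lambda>p. B (h p)) z"
proof -
  have keys: "Poly_Mapping.keys (frag_extend (\<lambda>p. frag_of (h p)) z) \<subseteq> X" if "Poly_Mapping.keys z \<subseteq> X" for z
    using keys_frag_extend[of "\<lambda>p. frag_of (h p)" z] h that by (auto simp: Pi_iff subset_iff)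
  have Bh: "(\<lambda>p. B (h p)) \<in> X \<rightarrow> carrier R" using B h by auto
  show ?thesis
  proof (rule frag_additive_eqI[OF _ _ _ _ _ z])
    show "frag_sum B (frag_extend (\<lambda>p. frag_of (h p)) z) \<in> carrier R"
      if "Poly_Mapping.keys z \<subseteq> X" for z
      using frag_sum_closed[OF B keys[OF that]] .
    show "frag_sum B (frag_extend (\<lambda>p. frag_of (h p)) (z + w)) =
        frag_sum B (frag_extend (\<lambda>p. frag_of (h p)) z) \<oplus> frag_sum B (frag_extend (\<lambda>p. frag_of (h p)) w)"
      if "Poly_Mapping.keys z \<subseteq> X" "Poly_Mapping.keys w \<subseteq> X" for z w
      using frag_sum_add[OF B keys[OF that(1)] keys[OF that(2)]] by (simp add: frag_extend_add)
    show "frag_sum B (frag_extend (\<lambda>p. frag_of (h p)) (frag_of p)) = frag_sum (\<lambda>p. B (h p)) (frag_of p)"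
      if "p \<in> X" for p
    proof -
      have "B (h p) \<in> carrier R" using B h that by auto
      then show ?thesis by (simp add: frag_sum_of)
    qed
  qed (auto intro: frag_sum_closed[OF Bh] frag_sum_add[OF Bh])
qed

lemma additive_frag_sum:
  assumes B: "B \<in> X \<rightarrow> carrier R" and z: "Poly_Mapping.keys z \<subseteq> X"
    and \<phi>: "\<And>r. r \<in> carrier R \<Longrightarrow> \<phi> r \<in> carrier R"
      "\<And>r r'. \<lbrakk>r \<in> carrier R; r' \<in> carrier R\<rbrakk> \<Longrightarrow> \<phi> (r \<oplus> r') = \<phi> r \<oplus> \<phi> r'"
  shows "\<phi> (frag_sum B z) = frag_sum (\<lambda>p. \<phi> (B p)) z"
proof -
  have \<phi>B: "(\<lambda>p. \<phi> (B p)) \<in> X \<rightarrow> carrier R" using B \<phi>(1) by auto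
  note closed = frag_sum_closed[OF B] frag_sum_closed[OF \<phi>B] and add = frag_sum_add[OF B] frag_sum_add[OF \<phi>B]
  show ?thesis
    by (rule frag_additive_eqI[OF _ _ _ _ _ z])
      (use B \<phi>(1) in \<open>auto simp: closed add \<phi> frag_sum_of Pi_iff\<close>)
qed

lemma finsum_frag_sum:
  fixes B :: "'q \<Rightarrow> 'p \<Rightarrow> 'a"
  assumes B: "\<And>a. a \<in> A \<Longrightarrow> B a \<in> X \<rightarrow> carrier R" and z: "Poly_Mapping.keys z \<subseteq> X" and A: "finite A"
  shows "(\<Oplus>a\<in>A. frag_sum (B a) z) = frag_sum (\<lambda>p. \<Oplus>a\<in>A. B a p) z"
proof -
  have sumB: "(\<lambda>p. \<Oplus>a\<in>A. B a p) \<in> X \<rightarrow> carrier R"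
    using B by (auto intro!: finsum_closed simp: Pi_iff)
  have closed: "frag_sum (B a) z \<in> carrier R" if "a \<in> A" "Poly_Mapping.keys z \<subseteq> X" for a z
    using frag_sum_closed[OF B that(2)] that(1) .
  show ?thesis
  proof (rule frag_additive_eqI[OF _ _ _ _ _ z])
    fix z w :: "'p \<Rightarrow>\<^sub>0 int" assume z: "Poly_Mapping.keys z \<subseteq> X" and w: "Poly_Mapping.keys w \<subseteq> X"
    have "(\<Oplus>a\<in>A. frag_sum (B a) (z + w)) = (\<Oplus>a\<in>A. frag_sum (B a) z \<oplus> frag_sum (B a) w)"
      using closed z w frag_sum_add[OF B z w] by (intro finsum_cong') auto
    also have "\<dots> = (\<Oplus>a\<in>A. frag_sum (B a) z) \<oplus> (\<Oplus>a\<in>A. frag_sum (B a) w)"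
      using closed z w by (intro finsum_addf) auto
    finally show "(\<Oplus>a\<in>A. frag_sum (B a) (z + w)) = (\<Oplus>a\<in>A. frag_sum (B a) z) \<oplus> (\<Oplus>a\<in>A. frag_sum (B a) w)" .
  next
    fix p assume "p \<in> X"
    then show "(\<Oplus>a\<in>A. frag_sum (B a) (frag_of p)) = frag_sum (\<lambda>p. \<Oplus>a\<in>A. B a p) (frag_of p)"
      using B sumB by (subst frag_sum_of) (auto intro!: finsum_cong' simp: frag_sum_of Pi_iff)
  qed (use closed frag_sum_closed[OF sumB] frag_sum_add[OF sumB] in \<open>auto intro!: finsum_closed\<close>)
qed

definition balanced :: "'a set \<Rightarrow> ('a \<times> 'a \<Rightarrow> 'a) \<Rightarrow> bool" where
  "balanced S B \<longleftrightarrow> B \<in> carrier R \<times> carrier R \<rightarrow> carrier R \<and>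
     (\<forall>u\<in>carrier R. \<forall>u'\<in>carrier R. \<forall>v\<in>carrier R. B (u \<oplus> u', v) = B (u, v) \<oplus> B (u', v)) \<and>
     (\<forall>u\<in>carrier R. \<forall>v\<in>carrier R. \<forall>v'\<in>carrier R. B (u, v \<oplus> v') = B (u, v) \<oplus> B (u, v')) \<and>
     (\<forall>u\<in>carrier R. \<forall>s\<in>S. \<forall>v\<in>carrier R. B (u \<otimes> s, v) = B (u, s \<otimes> v))"

abbreviation tensor_kernel :: "'a set \<Rightarrow> ('a \<times> 'a \<Rightarrow>\<^sub>0 int) set" where
  "tensor_kernel S \<equiv> generate (free_Abelian_group (carrier R \<times> carrier R))
     (tensor_relations (R\<lparr>carrier := S\<rparr>) (regular_bimodule R) (regular_bimodule R))"

text \<open>The kernel is generated by the relations of bilinearity and balance, which balanced maps respect. So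
  balanced maps are defined on \<open>R \<otimes>\<^sub>S R\<close>, whose elements are cosets of the kernel.\<close>
lemma balanced_vanishes:
  assumes S: "S \<subseteq> carrier R" and B: "balanced S B" and k: "k \<in> tensor_kernel S"
  shows "Poly_Mapping.keys k \<subseteq> carrier R \<times> carrier R \<and> frag_sum B k = \<zero>"
proof -
  let ?X = "carrier R \<times> carrier R"
  have BX: "B \<in> ?X \<rightarrow> carrier R" using B by (simp add: balanced_def)
  note closed = frag_sum_closed[OF BX] and add = frag_sum_add[OF BX]
  note diff = frag_additive_diff[of ?X "frag_sum B", OF closed add]
  have of: "frag_sum B (frag_of p) = B p" if "p \<in> ?X" for p
    using BX that by (intro frag_sum_of) auto
  have zero: "frag_sum B 0 = \<zero>" by (simp add: frag_sum_def)
  have two: "Poly_Mapping.keys (frag_of p - frag_of q) \<subseteq> ?X \<and> frag_sum B (frag_of p - frag_of q) = B p \<ominus> B q"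
    if "p \<in> ?X" "q \<in> ?X" for p q
    using that diff[of "frag_of p" "frag_of q"] keys_diff[of "frag_of p" "frag_of q"]
    by (auto simp: of)
  have three: "Poly_Mapping.keys (frag_of p - frag_of q - frag_of q') \<subseteq> ?X \<and>
      frag_sum B (frag_of p - frag_of q - frag_of q') = (B p \<ominus> B q) \<ominus> B q'"
    if "p \<in> ?X" "q \<in> ?X" "q' \<in> ?X" for p q q'
    using that diff[of "frag_of p - frag_of q" "frag_of q'"] two[OF that(1,2)]
      keys_diff[of "frag_of p - frag_of q" "frag_of q'"]
    by (auto simp: of)
  have cancel: "(a \<oplus> b) \<ominus> a \<ominus> b = \<zero>" "a \<ominus> a = \<zero>" if "a \<in> carrier R" "b \<in> carrier R" for a b
    using that by algebra+
  have rel: "Poly_Mapping.keys k \<subseteq> ?X \<and> frag_sum B k = \<zero>"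
    if k: "k \<in> tensor_relations (R\<lparr>carrier := S\<rparr>) (regular_bimodule R) (regular_bimodule R)" for k
  proof -
    from k consider
      (1) u u' v where "k = frag_of (u \<oplus> u', v) - frag_of (u, v) - frag_of (u', v)" "u \<in> carrier R" "u' \<in> carrier R" "v \<in> carrier R"
    | (2) u v v' where "k = frag_of (u, v \<oplus> v') - frag_of (u, v) - frag_of (u, v')" "u \<in> carrier R" "v \<in> carrier R" "v' \<in> carrier R"
    | (3) u s v where "k = frag_of (u \<otimes> s, v) - frag_of (u, s \<otimes> v)" "u \<in> carrier R" "s \<in> S" "v \<in> carrier R"
      unfolding tensor_relations_def by auto
    then show ?thesis
    proof cases
      case 1
      then have "B (u \<oplus> u', v) = B (u, v) \<oplus> B (u', v)" using B by (simp add: balanced_def)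
      moreover have "B (u, v) \<in> carrier R" "B (u', v) \<in> carrier R" using 1 BX by auto
      ultimately show ?thesis
        using three[of "(u \<oplus> u', v)" "(u, v)" "(u', v)"] 1 by (simp add: cancel)
    next
      case 2
      then have "B (u, v \<oplus> v') = B (u, v) \<oplus> B (u, v')" using B by (simp add: balanced_def)
      moreover have "B (u, v) \<in> carrier R" "B (u, v') \<in> carrier R" using 2 BX by auto
      ultimately show ?thesis
        using three[of "(u, v \<oplus> v')" "(u, v)" "(u, v')"] 2 by (simp add: cancel)
    next
      case 3
      then have s: "s \<in> carrier R" using S by blast
      have "B (u \<otimes> s, v) = B (u, s \<otimes> v)" using B 3 by (simp add: balanced_def)
      moreover have "B (u, s \<otimes> v) \<in> carrier R" using 3 s BX by auto
      ultimately show ?thesis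
        using two[of "(u \<otimes> s, v)" "(u, s \<otimes> v)"] 3 s by (simp add: cancel)
    qed
  qed
  show ?thesis
    using k
  proof (induction k rule: generate.induct)
    case one
    then show ?case by (simp add: zero)
  next
    case (incl h)
    then show ?case by (rule rel)
  next
    case (inv h)
    then show ?case
      using rel[OF inv] diff[of 0 h] by (auto simp: zero minus_eq)
  next
    case (eng h h')
    then show ?case
      using add[of h h'] keys_add[of h h'] by auto
  qed
qed

text \<open>A representative \<open>z\<close> of the image of 1 under a splitting of the multiplication map, with its two
  properties \<open>\<mu>(z) = 1\<close> and \<open>r z = z r\<close>. The second is an equation in the tensor product, expressed by testing
  against balanced maps.\<close>
lemma separability_element:
  assumes S: "subring S R" and sep: "separable_extension S R"
  obtains z where "Poly_Mapping.keys z \<subseteq> carrier R \<times> carrier R"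
    and "frag_sum (\<lambda>p. fst p \<otimes> snd p) z = \<one>"
    and "\<And>B r. \<lbrakk>balanced S B; r \<in> carrier R\<rbrakk> \<Longrightarrow>
      frag_sum (\<lambda>p. B (r \<otimes> fst p, snd p)) z = frag_sum (\<lambda>p. B (fst p, snd p \<otimes> r)) z"
proof -
  interpret S: subring S R by fact
  let ?X = "carrier R \<times> carrier R"
  let ?F = "free_Abelian_group ?X"
  let ?K = "tensor_kernel S"
  let ?T = "self_tensor S R"
  obtain \<sigma> where \<sigma>: "\<sigma> \<in> bimod_hom R R (regular_bimodule R) ?T"
    and split: "compose (carrier R) (multiplication_map S R) \<sigma> = (\<lambda>x\<in>carrier R. x)"
    using sep unfolding separable_extension_def by blast
  define C where "C = \<sigma> \<one>"
  have T_carrier: "carrier ?T = rcosets\<^bsub>?F\<^esub> ?K"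
    and T_left: "\<And>r D. r \<odot>\<^bsub>?T\<^esub> D = ?K <#>\<^bsub>?F\<^esub> frag_extend (\<lambda>p. frag_of (r \<otimes> fst p, snd p)) ` D"
    and T_right: "\<And>r D. rsmult ?T D r = ?K <#>\<^bsub>?F\<^esub> frag_extend (\<lambda>p. frag_of (fst p, snd p \<otimes> r)) ` D"
    by (simp_all add: self_tensor_def tensor_bimodule_def Let_def FactGroup_def case_prod_unfold)
  have C: "C \<in> carrier ?T"
    using \<sigma> by (auto simp: C_def bimod_hom_def mod_hom_def)
  then obtain z where z: "Poly_Mapping.keys z \<subseteq> ?X" and "C = (\<Union>k\<in>?K. {k + z})"
    unfolding T_carrier RCOSETS_def r_coset_def by auto
  then have Cz: "C = (\<lambda>k. k + z) ` ?K" by auto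
  have zero_K: "0 \<in> ?K" using generate.one[of ?F] by simp
  then have zC: "z \<in> C" unfolding Cz by force
  have coset: "Poly_Mapping.keys w \<subseteq> ?X \<and> frag_sum B w = frag_sum B z" if B: "balanced S B" and w: "w \<in> C" for B w
  proof -
    obtain k where k: "k \<in> ?K" "w = k + z" using w Cz by blast
    have BX: "B \<in> ?X \<rightarrow> carrier R" using B by (simp add: balanced_def)
    note kv = balanced_vanishes[OF S.subset B k(1)]
    show ?thesis
      using kv z k(2) keys_add[of k z] frag_sum_add[OF BX, of k z] frag_sum_closed[OF BX z] by auto
  qed
  show thesis
  proof (rule that[OF z])
    have "balanced S (\<lambda>p. fst p \<otimes> snd p)"
      using S.subset by (auto simp: balanced_def l_distr r_distr m_assoc subset_iff)
    then have "(\<lambda>c. frag_sum (\<lambda>p. fst p \<otimes> snd p) c) ` C = {frag_sum (\<lambda>p. fst p \<otimes> snd p) z}"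
      using coset zC by blast
    then have "multiplication_map S R C = frag_sum (\<lambda>p. fst p \<otimes> snd p) z"
      using C by (simp add: multiplication_map_def frag_sum_def)
    moreover have "multiplication_map S R C = \<one>"
      using fun_cong[OF split, of \<one>] by (simp add: compose_def C_def)
    ultimately show "frag_sum (\<lambda>p. fst p \<otimes> snd p) z = \<one>" by simp
  next
    fix B r assume B: "balanced S B" and r: "r \<in> carrier R"
    have BX: "B \<in> ?X \<rightarrow> carrier R" using B by (simp add: balanced_def)
    let ?l = "\<lambda>p. (r \<otimes> fst p, snd p)" and ?r = "\<lambda>p. (fst p, snd p \<otimes> r)"
    have "\<forall>r\<in>carrier R. \<forall>t\<in>carrier R. \<sigma> (r \<otimes> t) = r \<odot>\<^bsub>?T\<^esub> \<sigma> t"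
      using \<sigma> by (simp add: bimod_hom_def mod_hom_def)
    moreover have "\<forall>t\<in>carrier R. \<forall>r\<in>carrier R. \<sigma> (t \<otimes> r) = rsmult ?T (\<sigma> t) r"
      using \<sigma> by (simp add: bimod_hom_def)
    ultimately have "\<sigma> (r \<otimes> \<one>) = r \<odot>\<^bsub>?T\<^esub> C" "\<sigma> (\<one> \<otimes> r) = rsmult ?T C r"
      using r one_closed unfolding C_def by blast+
    then have eq: "r \<odot>\<^bsub>?T\<^esub> C = rsmult ?T C r" using r by simp
    \<comment> \<open>Both actions are images of cosets completed by the kernel, so a representative of one side is
      a representative of the other only up to an element of the kernel.\<close>
    have "frag_extend (\<lambda>p. frag_of (?l p)) z \<in> r \<odot>\<^bsub>?T\<^esub> C"
      unfolding T_left set_mult_def using zero_K zC by force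
    then obtain k w where k: "k \<in> ?K" and w: "w \<in> C"
      and lw: "frag_extend (\<lambda>p. frag_of (?l p)) z = k + frag_extend (\<lambda>p. frag_of (?r p)) w"
      unfolding eq T_right set_mult_def by auto
    have Br: "balanced S (\<lambda>p. B (?r p))"
      using B r S.subset unfolding balanced_def by (auto simp: l_distr m_assoc subset_iff)
    have wX: "Poly_Mapping.keys w \<subseteq> ?X" using coset[OF B w] by simp
    have keys: "Poly_Mapping.keys (frag_extend (\<lambda>p. frag_of (?r p)) w) \<subseteq> ?X"
      using keys_frag_extend[of "\<lambda>p. frag_of (?r p)" w] wX r by fastforce
    have "frag_sum (\<lambda>p. B (?l p)) z = frag_sum B (frag_extend (\<lambda>p. frag_of (?l p)) z)"
      using r by (intro frag_sum_frag_extend[OF BX _ z, symmetric]) auto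
    also have "\<dots> = frag_sum B (frag_extend (\<lambda>p. frag_of (?r p)) w)"
      unfolding lw
      using balanced_vanishes[OF S.subset B k] keys frag_sum_add[OF BX, of k] frag_sum_closed[OF BX keys] by simp
    also have "\<dots> = frag_sum (\<lambda>p. B (?r p)) w"
      using r by (intro frag_sum_frag_extend[OF BX _ wX]) auto
    also have "\<dots> = frag_sum (\<lambda>p. B (?r p)) z"
      using coset[OF Br w] by simp
    finally show "frag_sum (\<lambda>p. B (?l p)) z = frag_sum (\<lambda>p. B (?r p)) z" .
  qed
qed

end

text \<open>For a separability element \<open>\<Sum> u \<otimes> v\<close>, the map \<open>\<gamma> t = \<Sum> E(t u) v\<close> is left \<open>S\<close>-linear, and right
  \<open>R\<close>-linear because the element commutes with \<open>R\<close>. So \<open>\<gamma> t = c t\<close> with \<open>c = \<gamma> 1\<close>, which commutes with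
  \<open>S\<close>, and the sum of all \<open>x a \<gamma> a\<close> is \<open>\<Sum> u v = 1\<close> by the right expansion.\<close>
lemma (in frobenius_system) separable_central_element:
  assumes sep: "separable_extension S R"
  shows "\<exists>c\<in>carrier R. (\<forall>s\<in>S. c \<otimes> s = s \<otimes> c) \<and> (\<Oplus>a\<in>A. x a \<otimes> (c \<otimes> a)) = \<one>"
proof -
  let ?X = "carrier R \<times> carrier R"
  obtain z where z: "Poly_Mapping.keys z \<subseteq> ?X"
    and mult: "frag_sum (\<lambda>p. fst p \<otimes> snd p) z = \<one>"
    and comm: "\<And>B r. \<lbrakk>balanced S B; r \<in> carrier R\<rbrakk> \<Longrightarrow>
      frag_sum (\<lambda>p. B (r \<otimes> fst p, snd p)) z = frag_sum (\<lambda>p. B (fst p, snd p \<otimes> r)) z"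
    using separability_element[OF subring_S sep] by blast
  define B where "B t p = E (t \<otimes> fst p) \<otimes> snd p" for t and p :: "'a \<times> 'a"
  have BX: "B t \<in> ?X \<rightarrow> carrier R" if "t \<in> carrier R" for t
    using that by (auto simp: B_def)
  have bal: "balanced S (B t)" if t: "t \<in> carrier R" for t
  proof -
    have "E (t \<otimes> (u \<otimes> s)) = E (t \<otimes> u) \<otimes> s" if "u \<in> carrier R" "s \<in> S" for u s
      using that t E_right[of s "t \<otimes> u"] by (simp add: m_assoc)
    then show ?thesis
      using t BX[OF t] by (auto simp: balanced_def B_def r_distr l_distr E_add m_assoc)
  qed
  define \<gamma> where "\<gamma> t = frag_sum (B t) z" for t
  have \<gamma>_closed: "\<gamma> t \<in> carrier R" if "t \<in> carrier R" for t
    unfolding \<gamma>_def using frag_sum_closed[OF BX[OF that] z] .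
  have cong: "frag_sum f z = frag_sum g z" if "\<And>p. p \<in> ?X \<Longrightarrow> f p = g p" "f \<in> ?X \<rightarrow> carrier R" for f g
    unfolding frag_sum_def using that z by (intro finsum_cong') (auto simp: Pi_iff subset_iff)
  have \<gamma>_right: "\<gamma> (t \<otimes> r) = \<gamma> t \<otimes> r" if t: "t \<in> carrier R" and r: "r \<in> carrier R" for t r
  proof -
    have "\<gamma> (t \<otimes> r) = frag_sum (\<lambda>p. B t (r \<otimes> fst p, snd p)) z"
      unfolding \<gamma>_def using t r BX[of "t \<otimes> r"] by (intro cong) (auto simp: B_def m_assoc)
    also have "\<dots> = frag_sum (\<lambda>p. B t (fst p, snd p \<otimes> r)) z"
      using comm[OF bal[OF t] r] .
    also have "\<dots> = frag_sum (\<lambda>p. B t p \<otimes> r) z"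
      using t r by (intro cong) (auto simp: B_def m_assoc)
    also have "\<dots> = \<gamma> t \<otimes> r"
      unfolding \<gamma>_def using r by (intro additive_frag_sum[OF BX[OF t] z, symmetric]) (auto simp: l_distr)
    finally show ?thesis .
  qed
  have \<gamma>_left: "\<gamma> (s \<otimes> t) = s \<otimes> \<gamma> t" if s: "s \<in> S" and t: "t \<in> carrier R" for s t
  proof -
    have "\<gamma> (s \<otimes> t) = frag_sum (\<lambda>p. s \<otimes> B t p) z"
      unfolding \<gamma>_def using s t BX[of "s \<otimes> t"] by (intro cong) (auto simp: B_def m_assoc E_left)
    also have "\<dots> = s \<otimes> \<gamma> t"
      unfolding \<gamma>_def using s by (intro additive_frag_sum[OF BX[OF t] z, symmetric]) (auto simp: r_distr)
    finally show ?thesis .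
  qed
  let ?c = "\<gamma> \<one>"
  have central: "?c \<otimes> s = s \<otimes> ?c" if "s \<in> S" for s
    using \<gamma>_right[of \<one> s] \<gamma>_left[of s \<one>] that by simp
  have summand: "x a \<otimes> (?c \<otimes> a) = frag_sum (\<lambda>p. x a \<otimes> B a p) z" if a: "a \<in> A" for a
  proof -
    have "x a \<otimes> (?c \<otimes> a) = x a \<otimes> \<gamma> a"
      using \<gamma>_right[of \<one> a] a by simp
    also have "\<dots> = frag_sum (\<lambda>p. x a \<otimes> B a p) z"
      unfolding \<gamma>_def using a by (intro additive_frag_sum[OF BX z]) (auto simp: r_distr)
    finally show ?thesis .
  qed
  have "(\<Oplus>a\<in>A. x a \<otimes> (?c \<otimes> a)) = (\<Oplus>a\<in>A. frag_sum (\<lambda>p. x a \<otimes> B a p) z)"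
    by (intro finsum_cong') (auto simp: \<gamma>_closed simp flip: summand)
  also have "\<dots> = frag_sum (\<lambda>p. \<Oplus>a\<in>A. x a \<otimes> B a p) z"
    using BX z finite_A by (intro finsum_frag_sum) (auto simp: Pi_iff)
  also have "\<dots> = frag_sum (\<lambda>p. fst p \<otimes> snd p) z"
  proof (rule cong[symmetric])
    fix p assume "p \<in> ?X"
    then have p: "fst p \<in> carrier R" "snd p \<in> carrier R" by auto
    have "fst p \<otimes> snd p = (\<Oplus>a\<in>A. x a \<otimes> E (a \<otimes> fst p)) \<otimes> snd p"
      using p by (simp add: right_expansion)
    also have "\<dots> = (\<Oplus>a\<in>A. x a \<otimes> E (a \<otimes> fst p) \<otimes> snd p)"
      using p finite_A by (intro finsum_ldistr) auto
    also have "\<dots> = (\<Oplus>a\<in>A. x a \<otimes> B a p)"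
      using p by (intro finsum_cong') (auto simp: B_def m_assoc)
    finally show "fst p \<otimes> snd p = (\<Oplus>a\<in>A. x a \<otimes> B a p)" .
  qed auto
  finally have "(\<Oplus>a\<in>A. x a \<otimes> (?c \<otimes> a)) = \<one>" using mult by simp
  then show ?thesis using central \<gamma>_closed[of \<one>] by blast
qed

section \<open>Precovers over separable Frobenius extensions\<close>

theorem corollary2p9:
  fixes small :: "'u set \<Rightarrow> bool" and R :: "'u ring" and S :: "'u set"
  assumes "small_sets small"
    and "small (carrier R)"
    and "separable_frobenius_extension small S R"
    and "precovering small (R\<lparr>carrier := S\<rparr>) (gorenstein_projectives small (R\<lparr>carrier := S\<rparr>))"
  shows "precovering small R (gorenstein_projectives small R)"
proof -
  have frob: "frobenius_extension small S R" and sep: "separable_extension S R"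
    using assms(3) by (simp_all add: separable_frobenius_extension_def)
  obtain A x E where "frobenius_system S R A x E"
    using frobenius_extension_imp_system[OF assms(1,2) frob] by blast
  then interpret frobenius_system S R A x E .
  obtain c where c: "c \<in> carrier R" "\<And>s. s \<in> S \<Longrightarrow> c \<otimes>\<^bsub>R\<^esub> s = s \<otimes>\<^bsub>R\<^esub> c"
    "(\<Oplus>\<^bsub>R\<^esub>a\<in>A. x a \<otimes>\<^bsub>R\<^esub> (c \<otimes>\<^bsub>R\<^esub> a)) = \<one>\<^bsub>R\<^esub>"
    using separable_central_element[OF sep] by blast
  have "\<forall>N. \<exists>C :: ('u, 'u) module. \<exists>\<epsilon> \<eta>. N \<in> left_modules small S_ring \<longrightarrow>
      induced N C \<epsilon> \<eta> \<and> small (carrier C)"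
    using exists_small_induced[OF assms(1)] by blast
  then obtain Ind :: "('u, 'u) module \<Rightarrow> ('u, 'u) module" and \<epsilon> \<eta> where "\<And>N :: ('u, 'u) module. N \<in> left_modules small S_ring \<Longrightarrow>
      induced N (Ind N) (\<epsilon> N) (\<eta> N) \<and> small (carrier (Ind N))"
    by metis
  then interpret frobenius_induction S R A x E small Ind \<epsilon> \<eta>
    by unfold_locales blast+
  show ?thesis
    using c assms(4) by (rule precovering_induced)
qed

end
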